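(* Let $n\ge 1$, let $D$ be an $n$ strand Temperley-Lieb diagram, and let $S$ be the index set of $D$ (defined from the capform of $D$). Then the coefficient of $D$ in the Jones-Wenzl idempotent $f^{(n)}$ is $$\operatorname{coeff}_{\in f^{(n)}}(D) = \frac{1}{[n]!}\sum_{s\in S} [\tau(s)],$$ where $[n]! = [n][n-1]\cdots[1]$ and $[(t_1,\dots,t_n)] = [t_1]\cdots[t_n]$.
   Context: Quantum integers: $[n] = \frac{q^n-q^{-n}}{q-q^{-1}}$, with $q$ a formal parameter. Temperley-Lieb algebra: an $n$ strand Temperley-Lieb diagram is an isotopy class of planar diagrams in a rectangle with $n$ marked points on the upper edge and $n$ on the lower edge (each numbered $1,\dots,n$ from left to right), consisting of non-intersecting arcs joining these $2n$ points in pairs. $TL_n$ is the algebra over $\mathbb{C}(q)$ with basis the $n$ strand diagrams, and product given by stacking, each closed loop being removed and replaced by a factor $-[2]$. $e_i$ ($1\le i\le n-1$) is the diagram joining upper points $i,i+1$ to each other, lower points $i,i+1$ to each other, with all other strands vertical. Jones-Wenzl idempotent: $f^{(n)} \in TL_n$ is the unique element with $f^{(n)}\neq 0$, $f^{(n)}f^{(n)}=f^{(n)}$, and $e_i f^{(n)} = f^{(n)} e_i = 0$ for all $i\in\{1,\dots,n-1\}$. $\operatorname{coeff}_{\in f^{(n)}}(D)$ is the coefficient of $D$ when $f^{(n)}$ is expanded in the diagram basis. Capform: the capform of $D$ is obtained by folding the upper edge down to the right, giving $n$ non-crossing caps on $2n$ points on a line, numbered $1,\dots,2n$ from left to right: lower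 point $j$ of $D$ becomes point $j$, and upper point $j$ of $D$ becomes point $2n+1-j$. Each cap has a left end and a right end. Index set: $S$ is the set of sequences $(s_1,\dots,s_n)$ of positive integers such that: the $s_i$ are all distinct; $1\le s_i\le n+i-1$ for each $i$; each $s_i$ is the position of the left end of a cap in the capform of $D$; and, writing $\tilde s_i$ for the position of the right end of the cap with left end $s_i$, whenever $i<j$ and $s_i<s_j$ one has $\tilde s_i<s_j$. The map $\tau$: for $s\in S$, $\kappa(s)_i = \#\{1\le j\le i-1 : s_j<s_i\}$ and $\tau(s) = s-2\kappa(s)$, i.e. $\tau(s)_i = s_i - 2\kappa(s)_i$. *)

theory Defs
  imports
    "HOL-Computational_Algebra.Computational_Algebra"
    "HOL-Library.Disjoint_Sets"
    "HOL-Library.FuncSet"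
begin

section \<open>Quantum integers\<close>

type_synonym ratfun = "complex poly fract"

definition q :: ratfun where
  "q = Fract [:0, 1:] 1"

definition qint :: "int \<Rightarrow> ratfun" where
  "qint k = (q powi k - q powi (- k)) / (q - q powi (- 1))"

definition qfact :: "nat \<Rightarrow> ratfun" where
  "qfact n = (\<Prod>k = 1..n. qint (int k))"

section \<open>Temperley-Lieb diagrams\<close>

datatype point = Lower nat | Upper nat

definition points :: "nat \<Rightarrow> point set" where
  "points n = Lower ` {1..n} \<union> Upper ` {1..n}"

text \<open>
  The position of a marked point on the boundary of the rectangle, read counterclockwise
  from the lower left corner.  This is also its number after folding the upper edge down
  to the right.
\<close>

fun pos :: "nat \<Rightarrow> point \<Rightarrow> nat" where
  "pos n (Lower j) = j"
| "pos n (Upper j) = 2 * n + 1 - j"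

definition crossing :: "nat \<Rightarrow> point set \<Rightarrow> point set \<Rightarrow> bool" where
  "crossing n A B \<longleftrightarrow> (\<exists>a\<in>A. \<exists>b\<in>B. \<exists>c\<in>A. \<exists>d\<in>B.
     pos n a < pos n b \<and> pos n b < pos n c \<and> pos n c < pos n d)"

text \<open>
  An isotopy class of planar diagrams is determined by which points are joined; a perfect
  matching of the boundary points is realised by disjoint arcs in the rectangle exactly when no
  two of its pairs interleave along the boundary.
\<close>

type_synonym diagram = "point set set"

definition diagrams :: "nat \<Rightarrow> diagram set" where
  "diagrams n = {D. partition_on (points n) D \<and> (\<forall>A\<in>D. card A = 2) \<and>
     (\<forall>A\<in>D. \<forall>B\<in>D. \<not> crossing n A B)}"

definition cup_cap :: "nat \<Rightarrow> nat \<Rightarrow> diagram" where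
  "cup_cap n i = {{Upper i, Upper (i + 1)}, {Lower i, Lower (i + 1)}} \<union>
     {{Upper j, Lower j} | j. j \<in> {1..n} - {i, i + 1}}"

section \<open>Stacking\<close>

text \<open>
  The first diagram is placed on top of the second, the lower points of the first being
  identified with the upper points of the second.
\<close>

datatype site = Top nat | Mid nat | Bot nat

fun upper_site :: "point \<Rightarrow> site" where
  "upper_site (Upper j) = Top j"
| "upper_site (Lower j) = Mid j"

fun lower_site :: "point \<Rightarrow> site" where
  "lower_site (Upper j) = Mid j"
| "lower_site (Lower j) = Bot j"

fun outer_site :: "point \<Rightarrow> site" where
  "outer_site (Upper j) = Top j"
| "outer_site (Lower j) = Bot j"

definition glued_arcs :: "diagram \<Rightarrow> diagram \<Rightarrow> site set set" where
  "glued_arcs A B = (\<lambda>a. upper_site ` a) ` A \<union> (\<lambda>b. lower_site ` b) ` B"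

definition connected_sites :: "diagram \<Rightarrow> diagram \<Rightarrow> site rel" where
  "connected_sites A B = {(x, y). \<exists>a\<in>glued_arcs A B. x \<in> a \<and> y \<in> a}\<^sup>*"

definition stack :: "nat \<Rightarrow> diagram \<Rightarrow> diagram \<Rightarrow> diagram" where
  "stack n A B = {{x, y} | x y. x \<in> points n \<and> y \<in> points n \<and> x \<noteq> y \<and>
     (outer_site x, outer_site y) \<in> connected_sites A B}"

text \<open>A closed loop is a connected component that meets only the middle line.\<close>

definition loops :: "nat \<Rightarrow> diagram \<Rightarrow> diagram \<Rightarrow> nat" where
  "loops n A B = card {C. \<exists>j\<in>{1..n}. C = connected_sites A B `` {Mid j} \<and> C \<subseteq> Mid ` {1..n}}"

section \<open>The Temperley-Lieb algebra and the Jones-Wenzl idempotent\<close>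

text \<open>
  An element is its coefficient function with respect to the diagram basis (which is finite),
  so the coefficient of \<open>D\<close> in \<open>x\<close> is \<open>x D\<close>.
\<close>

type_synonym tl = "diagram \<Rightarrow> ratfun"

definition TL :: "nat \<Rightarrow> tl set" where
  "TL n = {x. \<forall>D. D \<notin> diagrams n \<longrightarrow> x D = 0}"

definition tl_zero :: tl where
  "tl_zero = (\<lambda>_. 0)"

definition basis :: "diagram \<Rightarrow> tl" where
  "basis D = (\<lambda>E. if E = D then 1 else 0)"

definition tl_mult :: "nat \<Rightarrow> tl \<Rightarrow> tl \<Rightarrow> tl" where
  "tl_mult n x y = (\<lambda>D. \<Sum>(A, B) \<in> {(A, B). A \<in> diagrams n \<and> B \<in> diagrams n \<and> stack n A B = D}.
     x A * y B * (- qint 2) ^ loops n A B)"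

definition tl_e :: "nat \<Rightarrow> nat \<Rightarrow> tl" where
  "tl_e n i = basis (cup_cap n i)"

definition is_jones_wenzl :: "nat \<Rightarrow> tl \<Rightarrow> bool" where
  "is_jones_wenzl n f \<longleftrightarrow> f \<in> TL n \<and> f \<noteq> tl_zero \<and> tl_mult n f f = f \<and>
     (\<forall>i\<in>{1..<n}. tl_mult n (tl_e n i) f = tl_zero \<and> tl_mult n f (tl_e n i) = tl_zero)"

definition jones_wenzl :: "nat \<Rightarrow> tl" where
  "jones_wenzl n = (THE f. is_jones_wenzl n f)"

section \<open>Capform and index set\<close>

definition capform :: "nat \<Rightarrow> diagram \<Rightarrow> nat set set" where
  "capform n D = (\<lambda>A. pos n ` A) ` D"

definition left_ends :: "nat \<Rightarrow> diagram \<Rightarrow> nat set" where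
  "left_ends n D = {l. \<exists>r. l < r \<and> {l, r} \<in> capform n D}"

definition right_end :: "nat \<Rightarrow> diagram \<Rightarrow> nat \<Rightarrow> nat" where
  "right_end n D l = (THE r. l < r \<and> {l, r} \<in> capform n D)"

text \<open>
  Sequences of length \<open>n\<close> are functions on \<open>{1..n}\<close>, extensional so that each sequence
  is represented exactly once.
\<close>

definition index_set :: "nat \<Rightarrow> diagram \<Rightarrow> (nat \<Rightarrow> nat) set" where
  "index_set n D = {s \<in> {1..n} \<rightarrow>\<^sub>E {1..}.
     inj_on s {1..n} \<and>
     (\<forall>i\<in>{1..n}. s i \<le> n + i - 1) \<and>
     (\<forall>i\<in>{1..n}. s i \<in> left_ends n D) \<and>
     (\<forall>i\<in>{1..n}. \<forall>j\<in>{1..n}. i < j \<and> s i < s j \<longrightarrow> right_end n D (s i) < s j)}"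

definition kappa :: "(nat \<Rightarrow> nat) \<Rightarrow> nat \<Rightarrow> nat" where
  "kappa s i = card {j \<in> {1..<i}. s j < s i}"

definition tau :: "(nat \<Rightarrow> nat) \<Rightarrow> nat \<Rightarrow> int" where
  "tau s i = int (s i) - 2 * int (kappa s i)"

definition qint_seq :: "nat \<Rightarrow> (nat \<Rightarrow> int) \<Rightarrow> ratfun" where
  "qint_seq n t = (\<Prod>i = 1..n. qint (t i))"

end

theory Submission
  imports Defs
begin

text \<open>
  View diagrams as non-crossing matchings of \<open>{1..2n}\<close>.  By the nesting condition, an index sequence
  removes the caps one by one, innermost first, and \<open>\<tau>(s)\<^sub>i\<close> is the position of the
  \<open>i\<close>-th removed cap among the points still present; moreover the bound \<open>s\<^sub>i \<le> n + i - 1\<close>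
  is preserved when the first entry is split off.  Hence the vector \<open>v\<^sub>n\<close> with coefficients
  \<open>\<Sum>s. [\<tau>(s)]\<close> satisfies \<open>v\<^sub>n = \<Sum>p=1..n. [p] I\<^sub>p v\<^sub>n\<^sub>-\<^sub>1\<close>, where \<open>I\<^sub>p\<close> inserts a cap at position \<open>p\<close>.
  Contracting the points \<open>i, i + 1\<close> with \<open>i < n\<close> annihilates \<open>v\<^sub>n\<close>: the terms
  \<open>p = i - 1, i, i + 1\<close> add up to \<open>([i - 1] - [2][i] + [i + 1]) v\<^sub>n\<^sub>-\<^sub>1 = 0\<close>, and in all other terms the
  contraction commutes past the insertion and induction applies.

  So \<open>g = v\<^sub>n / [n]!\<close> satisfies \<open>g e\<^sub>i = 0\<close> and has coefficient 1 at the identity.  If \<open>x\<close> is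
  annihilated by the \<open>e\<^sub>i\<close> from the right, then \<open>x D = 0\<close> for every other diagram \<open>D\<close>, since \<open>D\<close>
  has a cup on its upper edge.  With \<open>g*\<close> the reflection of \<open>g\<close> this gives
  \<open>g = g g* = g*\<close>, so the annihilation is two-sided, and \<open>f = f g = g\<close> for any other candidate \<open>f\<close>.
\<close>

section \<open>Quantum integers\<close>

text \<open>As a fraction, \<open>q ^ k\<close> is a monomial of degree \<open>k\<close> over 1, so
  the degree separates it from 1. That \<open>q\<close> is not a root of unity is what makes all
  denominators below nonzero.\<close>

lemma q_power_neq_1: "q ^ k \<noteq> 1" if "k > 0"
proof
  assume "q ^ k = 1"
  have "q ^ k = Fract ([:0, 1:] ^ k) 1" for k
    by (induction k) (simp_all add: q_def One_fract_def)
  with \<open>q ^ k = 1\<close> have "Fract ([:0, 1:] ^ k) 1 = (Fract 1 1 :: ratfun)"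
    by (simp add: One_fract_def)
  then have "[:0, 1:] ^ k = (1 :: complex poly)"
    by (simp add: eq_fract)
  then have "degree ([:0, 1 :: complex:] ^ k) = 0" by simp
  then show False using that by (simp add: degree_power_eq)
qed

lemma q_nonzero: "q \<noteq> 0"
  by (simp add: q_def Zero_fract_def eq_fract)

lemma q_minus_inverse_nonzero: "q - q powi (- 1) \<noteq> 0"
proof
  assume "q - q powi (- 1) = 0"
  then have "q ^ 2 = 1"
    using q_nonzero by (simp add: power_int_minus field_simps power2_eq_square)
  then show False using q_power_neq_1[of 2] by simp
qed

lemma qint_0 [simp]: "qint 0 = 0"
  and qint_1 [simp]: "qint 1 = 1"
  using q_minus_inverse_nonzero by (simp_all add: qint_def)

text \<open>A zero would mean \<open>q ^ (2 * k) = 1\<close>. This permits division by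
  \<open>[n]!\<close> and cancellation of the loop value \<open>- [2]\<close>.\<close>

lemma qint_nonzero: "qint k \<noteq> 0" if "k > 0"
proof
  assume "qint k = 0"
  then have *: "q powi k = inverse (q powi k)"
    using q_minus_inverse_nonzero by (simp add: qint_def power_int_minus)
  have "q powi k \<noteq> 0" using q_nonzero by simp
  with * have "q powi k * q powi k = 1"
    by (metis right_inverse)
  then have "q ^ (nat k + nat k) = 1"
    using that by (simp add: power_int_def power_add)
  then show False using q_power_neq_1[of "nat k + nat k"] that by simp
qed

text \<open>The Chebyshev recurrence, with \<open>[2] = q + 1/q\<close>. It makes the three
  surviving terms in \<open>weight_contract\<close> cancel.\<close>

lemma qint_rec: "qint (k - 1) + qint (k + 1) = qint 2 * qint k"
proof -
  define a where "a = q powi k"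
  define b where "b = q powi (- k)"
  have ks: "- (k - 1) = - k + 1" "- (k + 1) = - k - 1" by simp_all
  have sh: "q powi (k - 1) = a / q" "q powi (k + 1) = a * q"
    "q powi (- (k - 1)) = b * q" "q powi (- (k + 1)) = b / q"
    unfolding ks a_def b_def
    using q_nonzero by (simp_all add: power_int_diff power_int_add power_int_minus field_simps)
  have d: "q - inverse q \<noteq> 0" using q_minus_inverse_nonzero by (simp add: power_int_minus)
  have "qint 2 = (q\<^sup>2 - inverse (q\<^sup>2)) / (q - inverse q)"
    by (simp add: qint_def power_int_minus)
  also have "\<dots> = q + inverse q"
    using d q_nonzero by (simp add: divide_eq_eq) (simp add: field_simps power2_eq_square)
  finally have q2: "qint 2 = q + inverse q" .
  have "qint (k - 1) + qint (k + 1) = ((a / q - b * q) + (a * q - b / q)) / (q - inverse q)"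
    unfolding qint_def sh by (simp add: power_int_minus add_divide_distrib)
  also have "(a / q - b * q) + (a * q - b / q) = (q + inverse q) * (a - b)"
    by (simp add: divide_inverse algebra_simps)
  finally show ?thesis
    unfolding q2 qint_def[of k] a_def b_def by (simp add: power_int_minus)
qed

section \<open>Non-crossing matchings\<close>

text \<open>Total involutions that fix everything outside the \<open>2 * n\<close> points, so that
  equal matchings are equal functions. A chain \<open>x < y < m x < m y\<close> moves both
  \<open>x\<close> and \<open>y\<close>, so the quantifiers over all naturals only speak of matched
  points.\<close>

definition ncm :: "nat \<Rightarrow> (nat \<Rightarrow> nat) set" where
  "ncm n = {m. (\<forall>x. m (m x) = x) \<and> (\<forall>x. m x \<noteq> x \<longleftrightarrow> x \<in> {1..2 * n}) \<and>
     (\<forall>x y. \<not> (x < y \<and> y < m x \<and> m x < m y))}"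

section \<open>Inserting and contracting caps\<close>

definition up :: "nat \<Rightarrow> nat \<Rightarrow> nat" where
  "up p x = (if x < p then x else x + 2)"

text \<open>A left inverse of \<open>up p\<close>, the order embedding that leaves a gap at
  \<open>p\<close> and \<open>p + 1\<close>. Values of \<open>down p\<close> inside the gap carry no
  meaning.\<close>

definition down :: "nat \<Rightarrow> nat \<Rightarrow> nat" where
  "down p x = (if x < p then x else x - 2)"

definition insert_cap :: "nat \<Rightarrow> (nat \<Rightarrow> nat) \<Rightarrow> nat \<Rightarrow> nat" where
  "insert_cap p m x = (if x = p then p + 1 else if x = p + 1 then p else up p (m (down p x)))"

text \<open>Models an extra arc that joins \<open>i\<close> and \<open>i + 1\<close> from below:
  their partners become partners of each other. \<open>contract\<close> then drops both points and
  renumbers the rest.\<close>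

definition reroute :: "nat \<Rightarrow> (nat \<Rightarrow> nat) \<Rightarrow> nat \<Rightarrow> nat" where
  "reroute i m x = (if m x = i then m (i + 1) else if m x = i + 1 then m i else m x)"

definition contract :: "nat \<Rightarrow> (nat \<Rightarrow> nat) \<Rightarrow> nat \<Rightarrow> nat" where
  "contract i m x = down i (reroute i m (up i x))"

lemma down_up [simp]: "down p (up p x) = x"
  by (simp add: up_def down_def)

lemma up_down: "up p (down p x) = x" if "x \<noteq> p" "x \<noteq> p + 1"
  using that by (auto simp: up_def down_def)

lemma up_neq [simp]: "up p x \<noteq> p" "up p x \<noteq> Suc p" "p \<noteq> up p x"  "Suc p \<noteq> up p x"
  by (auto simp: up_def)

lemma up_less_iff [simp]: "up p x < up p y \<longleftrightarrow> x < y"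
  by (auto simp: up_def)

lemma up_eq_iff [simp]: "up p x = up p y \<longleftrightarrow> x = y"
  by (auto simp: up_def)

lemma up_less_base: "up p x < Suc p \<longleftrightarrow> up p x < p" "Suc p < up p x \<longleftrightarrow> p < up p x"
  by (auto simp: up_def)

lemma ncm_invol: "m \<in> ncm n \<Longrightarrow> m (m x) = x"
  and ncm_neq: "m \<in> ncm n \<Longrightarrow> m x \<noteq> x \<longleftrightarrow> x \<in> {1..2 * n}"
  and ncm_cross: "m \<in> ncm n \<Longrightarrow> x < y \<Longrightarrow> y < m x \<Longrightarrow> m x < m y \<Longrightarrow> False"
  unfolding ncm_def by blast+

lemma ncm_eq_iff: "m \<in> ncm n \<Longrightarrow> m x = m y \<longleftrightarrow> x = y"
  by (metis ncm_invol)

lemma ncm_range: "m \<in> ncm n \<Longrightarrow> m x \<in> {1..2 * n} \<longleftrightarrow> x \<in> {1..2 * n}"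
  by (metis ncm_invol ncm_neq)

lemma insert_cap_base [simp]: "insert_cap p m p = Suc p" "insert_cap p m (Suc p) = p"
  by (simp_all add: insert_cap_def)

lemma insert_cap_up [simp]: "insert_cap p m (up p x) = up p (m x)"
  by (simp add: insert_cap_def)

lemma up_cases:
  obtains "x = p" | "x = Suc p" | y where "x = up p y"
  using up_down[of x p] by (metis Suc_eq_plus1)

lemma insert_cap_ncm:
  assumes m: "m \<in> ncm n" and p: "1 \<le> p" "p \<le> 2 * n + 1"
  shows "insert_cap p m \<in> ncm (Suc n)"
proof -
  have "insert_cap p m (insert_cap p m x) = x" for x
    by (cases x rule: up_cases[of _ p]) (simp_all add: ncm_invol[OF m])
  moreover have "insert_cap p m x \<noteq> x \<longleftrightarrow> x \<in> {1..2 * Suc n}" for x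
  proof (cases x rule: up_cases[of _ p])
    case (3 y)
    have "up p y \<in> {1..2 * Suc n} \<longleftrightarrow> y \<in> {1..2 * n}"
      using p by (auto simp: up_def)
    then show ?thesis using 3 ncm_neq[OF m, of y] by simp
  qed (use p in simp_all)
  moreover have False if "x < y" "y < insert_cap p m x" "insert_cap p m x < insert_cap p m y" for x y
  proof (cases x rule: up_cases[of _ p])
    case x: (3 x')
    show ?thesis
    proof (cases y rule: up_cases[of _ p])
      case (3 y')
      then show ?thesis using that x ncm_cross[OF m, of x' y'] by simp
    qed (use that x in \<open>simp_all add: up_less_base\<close>)
  qed (use that in simp_all)
  ultimately show ?thesis unfolding ncm_def by blast
qed

lemma contract_insert_cap_same: "contract i (insert_cap i m) = m"
  by (rule ext) (simp add: contract_def reroute_def)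

text \<open>The zigzag identity: the arc from \<open>i\<close> to \<open>i + 1\<close> and the cap
  from \<open>i + 1\<close> to \<open>i + 2\<close> straighten to one strand, so
  \<open>i + 2\<close> inherits the partner of \<open>i\<close> and drops back to position
  \<open>i\<close>.\<close>

lemma contract_insert_cap_Suc:
  assumes "\<And>x. m (m x) = x" "m i \<noteq> i"
  shows "contract i (insert_cap (Suc i) m) = m"
proof
  fix x
  show "contract i (insert_cap (Suc i) m) x = m x"
    using assms(2) assms(1)[of x] assms(1)[of i]
    by (auto simp: contract_def reroute_def insert_cap_def up_def down_def)
qed

text \<open>The mirrored zigzag: insertion pushes the old point \<open>i\<close> to
  \<open>i + 2\<close>, and its strand comes back to \<open>i\<close> through the contraction arc
  and the cap.\<close>

lemma contract_Suc_insert_cap: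
  assumes "\<And>x. m (m x) = x" "m i \<noteq> i"
  shows "contract (Suc i) (insert_cap i m) = m"
proof
  fix x
  show "contract (Suc i) (insert_cap i m) x = m x"
    using assms(2) assms(1)[of x] assms(1)[of i]
    by (auto simp: contract_def reroute_def insert_cap_def up_def down_def)
qed

lemma up_up: "i \<le> j \<Longrightarrow> up (j + 2) (up i x) = up i (up j x)"
  by (auto simp: up_def)

text \<open>Guarantees that \<open>contract\<close> applies \<open>down\<close> outside its gap,
  where \<open>up\<close> undoes it.\<close>

lemma reroute_base:
  assumes "\<And>x. m (m x) = x" "m i \<noteq> i" "m (i + 1) \<noteq> i + 1" "x \<notin> {i, i + 1}"
  shows "reroute i m x \<notin> {i, i + 1}"
  using assms unfolding reroute_def by (smt (verit, best) insert_iff singletonD)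

text \<open>The cap lies to the right of the contracted points, so the two operations act on
  disjoint places; only the position of the cap drops by two when \<open>i\<close> and
  \<open>i + 1\<close> disappear.\<close>

lemma contract_insert_cap_ge:
  assumes "\<And>x. m (m x) = x" "i \<le> j" "m i \<noteq> i" "m (i + 1) \<noteq> i + 1"
  shows "contract i (insert_cap (j + 2) m) = insert_cap j (contract i m)"
proof
  fix x
  show "contract i (insert_cap (j + 2) m) x = insert_cap j (contract i m) x"
  proof (cases x rule: up_cases[of _ j])
    case 1
    then show ?thesis using assms(2)
      by (simp add: contract_def reroute_def insert_cap_def up_def down_def)
  next
    case 2
    then show ?thesis using assms(2)
      by (simp add: contract_def reroute_def insert_cap_def up_def down_def)
  next
    case (3 y)
    have *: "insert_cap (j + 2) m (up i x) = up (j + 2) (m (up i y))"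
      unfolding 3 using up_up[OF assms(2)] by (metis insert_cap_up)
    have r: "reroute i m (up i y) \<noteq> i" "reroute i m (up i y) \<noteq> i + 1"
      using reroute_base[OF assms(1,3,4), of "up i y"] by auto
    have i: "insert_cap (j + 2) m i = up (j + 2) (m i)" "insert_cap (j + 2) m (i + 1) = up (j + 2) (m (i + 1))"
      using insert_cap_up[of "j + 2" m i] insert_cap_up[of "j + 2" m "i + 1"] assms(2)
      by (simp_all add: up_def)
    have e: "up (j + 2) z = i \<longleftrightarrow> z = i" "up (j + 2) z = i + 1 \<longleftrightarrow> z = i + 1" for z
      using assms(2) by (auto simp: up_def)
    have "reroute i (insert_cap (j + 2) m) (up i x) = up (j + 2) (reroute i m (up i y))"
      unfolding reroute_def * i e by simp
    then have "contract i (insert_cap (j + 2) m) x = down i (up (j + 2) (up i (down i (reroute i m (up i y)))))"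
      using up_down[OF r] by (simp add: contract_def)
    also have "\<dots> = up j (contract i m y)"
      unfolding up_up[OF assms(2)] by (simp add: contract_def)
    finally show ?thesis using 3 by simp
  qed
qed

text \<open>Here the cap lies to the left and keeps its position; the contracted points are the old
  \<open>i\<close> and \<open>i + 1\<close>, pushed up by two.\<close>

lemma contract_insert_cap_le:
  assumes "\<And>x. m (m x) = x" "j \<le> i" "m i \<noteq> i" "m (i + 1) \<noteq> i + 1"
  shows "contract (i + 2) (insert_cap j m) = insert_cap j (contract i m)"
proof
  fix x
  show "contract (i + 2) (insert_cap j m) x = insert_cap j (contract i m) x"
  proof (cases x rule: up_cases[of _ j])
    case 1
    then show ?thesis using assms(2)
      by (simp add: contract_def reroute_def insert_cap_def up_def down_def)
  next
    case 2
    then show ?thesis using assms(2)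
      by (simp add: contract_def reroute_def insert_cap_def up_def down_def)
  next
    case (3 y)
    have *: "insert_cap j m (up (i + 2) x) = up j (m (up i y))"
      unfolding 3 using up_up[OF assms(2)] by (metis insert_cap_up)
    have r: "reroute i m (up i y) \<noteq> i" "reroute i m (up i y) \<noteq> i + 1"
      using reroute_base[OF assms(1,3,4), of "up i y"] by auto
    have i: "insert_cap j m (i + 2) = up j (m i)" "insert_cap j m (i + 2 + 1) = up j (m (i + 1))"
      using insert_cap_up[of j m i] insert_cap_up[of j m "i + 1"] assms(2)
      by (simp_all add: up_def)
    have e: "up j z = i + 2 \<longleftrightarrow> z = i" "up j z = i + 2 + 1 \<longleftrightarrow> z = i + 1" for z
      using assms(2) by (auto simp: up_def)
    have "reroute (i + 2) (insert_cap j m) (up (i + 2) x) = up j (reroute i m (up i y))"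
      unfolding reroute_def * i e by simp
    then have "contract (i + 2) (insert_cap j m) x = down (i + 2) (up j (up i (down i (reroute i m (up i y)))))"
      using up_down[OF r] by (simp add: contract_def)
    also have "\<dots> = up j (contract i m y)"
      unfolding up_up[OF assms(2), symmetric] by (simp add: contract_def)
    finally show ?thesis using 3 by simp
  qed
qed

text \<open>Contracting and putting a cap back at \<open>i\<close> is what multiplication by
  \<open>e\<^sub>i\<close> from below does to a matching. This form avoids all renumbering.\<close>

lemma insert_cap_contract:
  assumes "\<And>x. m (m x) = x" "m i \<noteq> i" "m (i + 1) \<noteq> i + 1"
  shows "insert_cap i (contract i m) x = (if x = i then i + 1 else if x = i + 1 then i else reroute i m x)"
proof (cases x rule: up_cases[of _ i])
  case (3 y)
  then have "insert_cap i (contract i m) x = up i (down i (reroute i m x))"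
    by (simp add: contract_def)
  also have "\<dots> = reroute i m x"
    using reroute_base[OF assms, of x] 3 by (intro up_down) auto
  finally show ?thesis using 3 by simp
qed simp_all

lemma insert_cap_contract_cap:
  assumes m: "m \<in> ncm n" and "m i = Suc i"
  shows "insert_cap i (contract i m) = m"
proof
  fix x
  have i': "m (Suc i) = i" using assms ncm_invol by metis
  then show "insert_cap i (contract i m) x = m x"
    using assms(2) i' ncm_eq_iff[OF m, of x i] ncm_eq_iff[OF m, of x "Suc i"]
    by (subst insert_cap_contract[OF ncm_invol[OF m]]) (auto simp: reroute_def)
qed

lemma contract_cap_ncm:
  assumes m: "m \<in> ncm (Suc n)" and i: "m i = Suc i"
  shows "contract i m \<in> ncm n"
proof -
  have eq: "up i (contract i m x) = m (up i x)" for x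
    using insert_cap_contract_cap[OF assms] by (metis insert_cap_up)
  have "i \<in> {1..2 * Suc n}" "Suc i \<in> {1..2 * Suc n}"
    using ncm_neq[OF m, of i] ncm_range[OF m, of i] i by auto
  then have "contract i m x \<noteq> x \<longleftrightarrow> x \<in> {1..2 * n}" for x
    using ncm_neq[OF m, of "up i x"] unfolding eq[symmetric]
    by (auto simp: up_def split: if_splits)
  moreover have "contract i m (contract i m x) = x" for x
    using eq by (metis up_eq_iff ncm_invol[OF m])
  moreover have "\<not> (x < y \<and> y < contract i m x \<and> contract i m x < contract i m y)" for x y
    using ncm_cross[OF m, of "up i x" "up i y"] eq up_less_iff by metis
  ultimately show ?thesis by (simp add: ncm_def)
qed

section \<open>Innermost caps and the matching of the identity\<close>

lemma ncm_next_left: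
  assumes m: "m \<in> ncm n" and "x < m x" "m x \<noteq> Suc x"
  shows "Suc x < m (Suc x)" "m (Suc x) < m x"
proof -
  have lt: "Suc x < m x" using assms by simp
  have "x \<in> {1..2 * n}" "m x \<in> {1..2 * n}"
    using ncm_neq[OF m, of x] ncm_range[OF m, of x] assms by auto
  with lt have "Suc x \<in> {1..2 * n}" by auto
  then have ne: "m (Suc x) \<noteq> Suc x" using ncm_neq[OF m] by blast
  have "m (Suc x) \<noteq> x" using assms ncm_invol[OF m] by metis
  moreover have "\<not> m (Suc x) < x"
    using ncm_cross[OF m, of "m (Suc x)" x] lt ncm_invol[OF m] by auto
  ultimately show "Suc x < m (Suc x)" using ne by linarith
  show "m (Suc x) < m x"
    using ncm_cross[OF m, of x "Suc x"] lt ncm_eq_iff[OF m, of x "Suc x"]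
    by (meson lessI linorder_neqE_nat n_not_Suc_n)
qed

text \<open>As long as the cap is not between neighbours, \<open>ncm_next_left\<close> gives a
  strictly shorter cap nested inside it, starting at \<open>Suc x\<close>.\<close>

lemma ncm_innermost:
  assumes m: "m \<in> ncm n" and "x < m x"
  shows "\<exists>p\<ge>x. p < m x \<and> m p = Suc p"
  using assms(2)
proof (induction "m x - x" arbitrary: x rule: less_induct)
  case less
  show ?case
  proof (cases "m x = Suc x")
    case False
    note nx = ncm_next_left[OF m less.prems False]
    then have "m (Suc x) - Suc x < m x - x" using less.prems by linarith
    from less.hyps[OF this nx(1)] have "\<exists>p\<ge>Suc x. p < m (Suc x) \<and> m p = Suc p" .
    then obtain p where "Suc x \<le> p" "p < m (Suc x)" "m p = Suc p" by blast
    with nx(2) have "x \<le> p \<and> p < m x \<and> m p = Suc p" by linarith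
    then show ?thesis by blast
  qed auto
qed

text \<open>The capform of the identity diagram: all caps nested around the middle.\<close>

definition nest :: "nat \<Rightarrow> nat \<Rightarrow> nat" where
  "nest n x = (if x \<in> {1..2 * n} then 2 * n + 1 - x else x)"

lemma nest_ncm: "nest n \<in> ncm n"
  by (auto simp: ncm_def nest_def) presburger

text \<open>Positions above \<open>n\<close> are the upper points. If no two neighbours among them
  are joined, there is no innermost cap there, so every upper point goes to a lower one;
  non-crossing makes this map strictly decreasing, which leaves only the nested matching.\<close>

lemma ncm_nest_or_cap:
  assumes m: "m \<in> ncm n" and "m \<noteq> nest n"
  shows "\<exists>i. 1 \<le> i \<and> i < n \<and> m (2 * n - i) = Suc (2 * n - i)"
proof (rule ccontr)
  assume none: "\<not> ?thesis"
  have nocap: "m p \<noteq> Suc p" if "n < p" for p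
  proof
    assume p: "m p = Suc p"
    then have "Suc p \<in> {1..2 * n}"
      using ncm_neq[OF m, of p] ncm_range[OF m, of p] by auto
    then have "1 \<le> 2 * n - p" "2 * n - p < n" "2 * n - (2 * n - p) = p"
      using that by auto
    then show False using none p by metis
  qed
  have low: "m x \<le> n" if "n < x" "x \<le> 2 * n" for x
  proof (rule ccontr)
    assume "\<not> m x \<le> n"
    then have "n < m x" by simp
    have "m x \<noteq> x" using ncm_neq[OF m] that by auto
    then have "m x < m (m x) \<or> x < m x" using ncm_invol[OF m, of x] by auto
    with \<open>n < m x\<close> that(1) obtain y where "n < y" "y < m y" by blast
    then show False using ncm_innermost[OF m] nocap by (meson less_le_trans)
  qed
  have dec: "m y < m x" if "n < x" "x < y" "y \<le> 2 * n" for x y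
  proof (rule ccontr)
    assume "\<not> m y < m x"
    then have "m x < m y" using ncm_eq_iff[OF m, of x y] that by auto
    then show False
      using ncm_cross[OF m, of "m x" "m y"] low[of x] low[of y] that ncm_invol[OF m] by auto
  qed
  \<comment> \<open>Strict decrease, started at \<open>n + 1\<close> with a value of at most
    \<open>n\<close>, bounds the values from above; started at \<open>2 * n\<close> with a value of
    at least 1, it bounds them from below. The two bounds meet.\<close>
  have upper: "k < n \<Longrightarrow> m (n + 1 + k) \<le> n - k" for k
  proof (induction k)
    case 0
    then show ?case using low[of "n + 1"] by simp
  next
    case (Suc k)
    then show ?case using dec[of "n + 1 + k" "n + 1 + Suc k"] by simp
  qed
  have lower: "k < n \<Longrightarrow> k + 1 \<le> m (2 * n - k)" for k
  proof (induction k)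
    case 0
    then show ?case using ncm_range[OF m, of "2 * n"] by auto
  next
    case (Suc k)
    then have "n < 2 * n - Suc k" "2 * n - Suc k < 2 * n - k" by auto
    then have "m (2 * n - k) < m (2 * n - Suc k)" by (intro dec) auto
    then show ?case using Suc by simp
  qed
  have high: "m x = 2 * n + 1 - x" if "n < x" "x \<le> 2 * n" for x
  proof -
    have "x - n - 1 < n" "2 * n - x < n" "n + 1 + (x - n - 1) = x" "2 * n - (2 * n - x) = x"
      using that by auto
    then show ?thesis using upper[of "x - n - 1"] lower[of "2 * n - x"] that by simp
  qed
  have "m x = nest n x" for x
  proof (cases "x \<in> {1..2 * n}")
    case True
    show ?thesis
    proof (cases "n < x")
      case False
      then have "m (2 * n + 1 - x) = x" using True by (subst high) auto
      then show ?thesis using True ncm_invol[OF m, of "2 * n + 1 - x"] by (simp add: nest_def)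
    qed (use True high in \<open>simp add: nest_def\<close>)
  qed (use ncm_neq[OF m, of x] in \<open>auto simp: nest_def\<close>)
  then show False using assms by auto
qed

section \<open>Index sequences and their weights\<close>

text \<open>The index set transcribed to matchings: a left end is an \<open>x\<close> with
  \<open>x < m x\<close>, and its right end is \<open>m x\<close>. The agreement is
  \<open>index_set_diagram_of\<close>.\<close>

definition cap_seqs :: "nat \<Rightarrow> (nat \<Rightarrow> nat) \<Rightarrow> (nat \<Rightarrow> nat) set" where
  "cap_seqs n m = {s \<in> {1..n} \<rightarrow>\<^sub>E {1..}. inj_on s {1..n} \<and>
     (\<forall>i\<in>{1..n}. s i \<le> n + i - 1) \<and>
     (\<forall>i\<in>{1..n}. s i < m (s i)) \<and>
     (\<forall>i\<in>{1..n}. \<forall>j\<in>{1..n}. i < j \<and> s i < s j \<longrightarrow> m (s i) < s j)}"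

definition weight :: "nat \<Rightarrow> (nat \<Rightarrow> nat) \<Rightarrow> ratfun" where
  "weight n m = (\<Sum>s\<in>cap_seqs n m. qint_seq n (tau s))"

text \<open>The first entry is the cap removed first. The later entries come from a sequence for the
  matching without that cap, so their positions are shifted past the gap.\<close>

definition cons_seq :: "nat \<Rightarrow> nat \<Rightarrow> (nat \<Rightarrow> nat) \<Rightarrow> nat \<Rightarrow> nat" where
  "cons_seq n p s i = (if i = 1 then p else if i \<in> {2..Suc n} then up p (s (i - 1)) else undefined)"

definition tl_seq :: "nat \<Rightarrow> (nat \<Rightarrow> nat) \<Rightarrow> nat \<Rightarrow> nat" where
  "tl_seq n s i = (if i \<in> {1..n} then down (s 1) (s (Suc i)) else undefined)"

lemma cap_seqsD:
  assumes "s \<in> cap_seqs n m" "i \<in> {1..n}"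
  shows "1 \<le> s i" "s i \<le> n + i - 1" "s i < m (s i)"
    "j \<in> {1..n} \<Longrightarrow> i < j \<Longrightarrow> s i < s j \<Longrightarrow> m (s i) < s j"
    "j \<in> {1..n} \<Longrightarrow> s i = s j \<longleftrightarrow> i = j"
  using assms unfolding cap_seqs_def by (auto simp: PiE_iff inj_on_eq_iff)

lemma finite_cap_seqs [simp]: "finite (cap_seqs n m)"
proof (rule finite_subset)
  show "cap_seqs n m \<subseteq> {1..n} \<rightarrow>\<^sub>E {0..n + n}"
  proof
    fix s assume s: "s \<in> cap_seqs n m"
    then have "s i \<le> n + n" if "i \<in> {1..n}" for i
      using cap_seqsD(2)[OF s that] that by auto
    then show "s \<in> {1..n} \<rightarrow>\<^sub>E {0..n + n}"
      using s by (auto simp: cap_seqs_def PiE_iff)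
  qed
  show "finite ({1..n} \<rightarrow>\<^sub>E {0..n + n})" by (intro finite_PiE) auto
qed

section \<open>Splitting off the first entry of an index sequence\<close>

lemma card_left_ends:
  assumes m: "m \<in> ncm n"
  shows "card {x. x < m x} = n"
proof -
  let ?L = "{x. x < m x}" and ?R = "{x. m x < x}"
  have "bij_betw m ?L ?R"
    by (rule bij_betw_byWitness[of _ m]) (auto simp: ncm_invol[OF m])
  then have "card ?L = card ?R" by (rule bij_betw_same_card)
  moreover have un: "?L \<union> ?R = {1..2 * n}"
  proof (rule set_eqI)
    fix x show "x \<in> ?L \<union> ?R \<longleftrightarrow> x \<in> {1..2 * n}"
      using ncm_neq[OF m, of x] by auto
  qed
  moreover have "finite (?L \<union> ?R)" unfolding un by simp
  then have "card (?L \<union> ?R) = card ?L + card ?R"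
    by (intro card_Un_disjoint) auto
  ultimately show ?thesis by simp
qed

lemma finite_left_ends:
  assumes m: "m \<in> ncm n"
  shows "finite {x. x < m x}"
proof (rule finite_subset)
  show "{x. x < m x} \<subseteq> {1..2 * n}"
  proof
    fix x assume "x \<in> {x. x < m x}"
    then show "x \<in> {1..2 * n}" using ncm_neq[OF m, of x] by auto
  qed
qed simp

text \<open>By counting: \<open>n\<close> distinct entries among \<open>n\<close> left ends. So
  every cap has its turn in the sequence.\<close>

lemma cap_seqs_image:
  assumes m: "m \<in> ncm n" and s: "s \<in> cap_seqs n m"
  shows "s ` {1..n} = {x. x < m x}"
proof (rule card_subset_eq)
  show "finite {x. x < m x}" using m by (rule finite_left_ends)
  show "s ` {1..n} \<subseteq> {x. x < m x}" using cap_seqsD(3)[OF s] by auto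
  have "inj_on s {1..n}" using s by (simp add: cap_seqs_def)
  then show "card (s ` {1..n}) = card {x. x < m x}"
    using card_left_ends[OF m] by (simp add: card_image)
qed

text \<open>Otherwise \<open>Suc (s 1)\<close> opens a cap nested inside the first one. It occurs
  later in the sequence with a larger value, and the nesting condition would place it to the right
  of \<open>m (s 1)\<close>.\<close>

lemma cap_seqs_first:
  assumes m: "m \<in> ncm (Suc n)" and s: "s \<in> cap_seqs (Suc n) m"
  shows "m (s 1) = Suc (s 1)"
proof (rule ccontr)
  assume no: "m (s 1) \<noteq> Suc (s 1)"
  have lt: "s 1 < m (s 1)" using cap_seqsD(3)[OF s, of 1] by simp
  note nx = ncm_next_left[OF m lt no]
  then have "Suc (s 1) \<in> s ` {1..Suc n}" unfolding cap_seqs_image[OF m s] by simp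
  then obtain j where j: "j \<in> {1..Suc n}" "s j = Suc (s 1)" by auto
  then have "j \<noteq> 1" by auto
  then have "m (s 1) < s j" using cap_seqsD(4)[OF s, of 1 j] j by auto
  then show False using j lt no by simp
qed

lemma cons_seq_simps [simp]:
  "cons_seq n p s (Suc 0) = p"
  "i \<in> {1..n} \<Longrightarrow> cons_seq n p s (Suc i) = up p (s i)"
  by (auto simp: cons_seq_def)

lemma Suc_interval_cases:
  assumes "i \<in> {1..Suc n}"
  obtains "i = Suc 0" | k where "i = Suc k" "k \<in> {1..n}"
  using assms by (cases i) (auto simp: less_Suc_eq_le Suc_le_eq)

text \<open>The bound survives because passing from length \<open>n\<close> and index
  \<open>k\<close> to length \<open>Suc n\<close> and index \<open>Suc k\<close> raises it by
  exactly two, the most that \<open>up\<close> can add.\<close>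

lemma cons_seq_cap_seqs:
  assumes m: "m \<in> ncm n" and p: "p \<in> {1..Suc n}" and s: "s \<in> cap_seqs n m"
  shows "cons_seq n p s \<in> cap_seqs (Suc n) (insert_cap p m)"
proof -
  let ?c = "cons_seq n p s"
  have ext: "?c i = undefined" if "i \<notin> {1..Suc n}" for i
    using that by (auto simp: cons_seq_def)
  have each: "1 \<le> ?c i \<and> ?c i \<le> Suc n + i - 1 \<and> ?c i < insert_cap p m (?c i)"
    if "i \<in> {1..Suc n}" for i
    using that
  proof (cases rule: Suc_interval_cases)
    case (2 k)
    have "up p (s k) \<le> s k + 2" "s k \<le> up p (s k)" by (auto simp: up_def)
    then show ?thesis using 2 cap_seqsD(1,2,3)[OF s 2(2)] by auto
  qed (use p in auto)
  have pair: "?c i \<noteq> ?c j \<and> (?c i < ?c j \<longrightarrow> insert_cap p m (?c i) < ?c j)"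
    if ij: "i \<in> {1..Suc n}" "j \<in> {1..Suc n}" "i < j" for i j
  proof -
    obtain l where l: "j = Suc l" "l \<in> {1..n}"
    proof
      show "j = Suc (j - 1)" "j - 1 \<in> {1..n}" using ij by auto
    qed
    from ij(1) show ?thesis
    proof (cases rule: Suc_interval_cases)
      case 1
      then show ?thesis using l by (simp add: up_less_base)
    next
      case (2 k)
      then show ?thesis
        using l ij cap_seqsD(4,5)[OF s 2(2) l(2)] by auto
    qed
  qed
  have "inj_on ?c {1..Suc n}"
    by (rule linorder_inj_onI) (use pair in \<open>auto simp: linorder_neq_iff\<close>)
  with ext each pair show ?thesis unfolding cap_seqs_def by (auto simp: PiE_iff extensional_def)
qed

lemma tl_seq_cap_seqs:
  assumes m: "m \<in> ncm (Suc n)" and s: "s \<in> cap_seqs (Suc n) m"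
  shows "tl_seq n s \<in> cap_seqs n (contract (s 1) m)" "cons_seq n (s 1) (tl_seq n s) = s"
proof -
  define p where "p = s 1"
  let ?t = "tl_seq n s"
  have cap: "m p = Suc p" unfolding p_def by (rule cap_seqs_first[OF m s])
  have p: "1 \<le> p" "p \<le> Suc n" unfolding p_def using cap_seqsD(1,2)[OF s, of 1] by auto
  have m': "m (up p x) = up p (contract p m x)" for x
    using insert_cap_contract_cap[OF m cap] by (metis insert_cap_up)
  have up: "s (Suc i) = up p (?t i)" if i: "i \<in> {1..n}" for i
  proof -
    have "s (Suc i) \<noteq> p" using cap_seqsD(5)[OF s, of 1 "Suc i"] i by (auto simp: p_def)
    moreover have "m (Suc p) = p" using cap ncm_invol[OF m] by metis
    then have "s (Suc i) \<noteq> Suc p" using cap_seqsD(3)[OF s, of "Suc i"] i by auto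
    ultimately show ?thesis using i up_down[of "s (Suc i)" p] by (simp add: tl_seq_def p_def)
  qed
  have each: "1 \<le> ?t i \<and> ?t i \<le> n + i - 1 \<and> ?t i < contract p m (?t i)" if i: "i \<in> {1..n}" for i
  proof -
    have i': "Suc i \<in> {1..Suc n}" using i by simp
    note * = cap_seqsD[OF s i', unfolded up[OF i]]
    have "?t i < contract p m (?t i)"
      using *(3) m' by simp
    \<comment> \<open>Entries to the right of the gap lose two, just as the bound does. Entries to
      the left are below \<open>p\<close>, hence at most \<open>n\<close>, which the new bound
      allows since \<open>i\<close> is at least 1.\<close>
    moreover have "1 \<le> ?t i \<and> ?t i \<le> n + i - 1"
      using *(1,2) p i by (auto simp: up_def split: if_splits)
    ultimately show ?thesis by blast
  qed
  have pair: "(?t i < ?t j \<longrightarrow> contract p m (?t i) < ?t j) \<and> ?t i \<noteq> ?t j"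
    if ij: "i \<in> {1..n}" "j \<in> {1..n}" "i < j" for i j
  proof -
    have i': "Suc i \<in> {1..Suc n}" "Suc j \<in> {1..Suc n}" "Suc i < Suc j" using ij by auto
    note * = cap_seqsD(4,5)[OF s i'(1,2), unfolded up[OF ij(1)] up[OF ij(2)]]
    show ?thesis using * i'(3) m' by auto
  qed
  have "inj_on ?t {1..n}"
    by (rule linorder_inj_onI) (use pair in \<open>auto simp: linorder_neq_iff\<close>)
  with each pair have "?t \<in> cap_seqs n (contract p m)"
    unfolding cap_seqs_def by (auto simp: PiE_iff extensional_def tl_seq_def)
  then show "?t \<in> cap_seqs n (contract (s 1) m)" by (simp add: p_def)
  show "cons_seq n (s 1) ?t = s"
  proof
    fix i show "cons_seq n (s 1) ?t i = s i"
    proof (cases "i \<in> {1..Suc n}")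
      case True
      then show ?thesis
        by (cases rule: Suc_interval_cases) (use up in \<open>simp_all add: p_def\<close>)
    next
      case False
      then show ?thesis using s by (auto simp: cons_seq_def cap_seqs_def PiE_iff extensional_def)
    qed
  qed
qed

lemma tl_cons_seq:
  assumes "s \<in> cap_seqs n m"
  shows "tl_seq n (cons_seq n p s) = s"
proof
  fix i show "tl_seq n (cons_seq n p s) i = s i"
    using assms by (auto simp: tl_seq_def cap_seqs_def PiE_iff extensional_def)
qed

text \<open>An entry to the right of the first cap is raised by two, but it also gains one smaller
  predecessor in \<open>kappa\<close>; an entry to the left has neither change. So
  \<open>tau\<close> of the tail is unaffected.\<close>

lemma qint_seq_cons:
  "qint_seq (Suc n) (tau (cons_seq n p s)) = qint (int p) * qint_seq n (tau s)"
proof -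
  let ?c = "cons_seq n p s"
  have "tau ?c (Suc i) = tau s i" if i: "i \<in> {1..n}" for i
  proof -
    have "{j \<in> {1..<Suc i}. ?c j < ?c (Suc i)} =
      (if p < up p (s i) then {1} else {}) \<union> Suc ` {j \<in> {1..<i}. s j < s i}"
      (is "?A = ?B")
    proof (rule set_eqI)
      fix j show "j \<in> ?A \<longleftrightarrow> j \<in> ?B"
      proof (cases "j = 1")
        case True
        then show ?thesis using i by auto
      next
        case False
        show ?thesis
        proof (cases j)
          case (Suc k)
          then show ?thesis using i False by (auto simp: image_iff)
        qed (use False in auto)
      qed
    qed
    then have "kappa ?c (Suc i) = card ?B" by (simp add: kappa_def)
    also have "\<dots> = (if p < up p (s i) then 1 else 0) + kappa s i"
      by (subst card_Un_disjoint) (auto simp: card_image kappa_def)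
    finally have *: "kappa ?c (Suc i) = (if p < up p (s i) then 1 else 0) + kappa s i" .
    show ?thesis using i unfolding tau_def * by (auto simp: up_def)
  qed
  then have "(\<Prod>i = 1..n. qint (tau ?c (Suc i))) = (\<Prod>i = 1..n. qint (tau s i))"
    by (intro prod.cong) auto
  moreover have "(\<Prod>i = 1..Suc n. qint (tau ?c i)) =
      qint (tau ?c 1) * (\<Prod>i = 1..n. qint (tau ?c (Suc i)))"
    using prod.atLeast_Suc_atMost_Suc_shift[of "\<lambda>i. qint (tau ?c i)" 1 n]
    by (subst prod.atLeast_Suc_atMost) auto
  moreover have "tau ?c (Suc 0) = int p" by (simp add: tau_def kappa_def)
  ultimately show ?thesis
    unfolding qint_seq_def by simp
qed

section \<open>The recursion for the weights and its kernel property\<close>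

lemma finite_ncm [simp]: "finite (ncm n)"
proof (rule finite_subset)
  let ?F = "\<lambda>m. restrict m {1..2 * n}"
  let ?X = "(\<lambda>f x. if x \<in> {1..2 * n} then f x else x) ` ({1..2 * n} \<rightarrow>\<^sub>E {1..2 * n})"
  show "finite ?X" by (intro finite_imageI finite_PiE) auto
  show "ncm n \<subseteq> ?X"
  proof
    fix m assume m: "m \<in> ncm n"
    have "m = (\<lambda>x. if x \<in> {1..2 * n} then ?F m x else x)"
      using ncm_neq[OF m] by (intro ext) (metis restrict_apply)
    moreover have "?F m \<in> {1..2 * n} \<rightarrow>\<^sub>E {1..2 * n}"
      using ncm_range[OF m] by (auto intro!: restrict_PiE_iff[THEN iffD2])
    ultimately show "m \<in> ?X" by (intro image_eqI[where x = "?F m"]) simp_all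
  qed
qed

text \<open>The recursion for \<open>v\<^sub>n\<close>, paired with a test function \<psi>. Pairs of
  a matching and an index sequence correspond to triples of the first cap, the matching without it
  and the remaining sequence.\<close>

lemma weight_rec:
  "(\<Sum>m\<in>ncm (Suc n). weight (Suc n) m * \<psi> m) =
   (\<Sum>p = 1..Suc n. qint (int p) * (\<Sum>m\<in>ncm n. weight n m * \<psi> (insert_cap p m)))"
proof -
  let ?f = "\<lambda>(m, s). qint_seq (Suc n) (tau s) * \<psi> m"
  let ?g = "\<lambda>(p, m, s). qint (int p) * (qint_seq n (tau s) * \<psi> (insert_cap p m))"
  have "(\<Sum>m\<in>ncm (Suc n). weight (Suc n) m * \<psi> m) =
    (\<Sum>m\<in>ncm (Suc n). \<Sum>s\<in>cap_seqs (Suc n) m. ?f (m, s))"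
    by (simp add: weight_def sum_distrib_right)
  also have "\<dots> = sum ?f (Sigma (ncm (Suc n)) (cap_seqs (Suc n)))"
    by (subst sum.Sigma) auto
  also have "\<dots> = sum ?g ({1..Suc n} \<times> Sigma (ncm n) (cap_seqs n))"
  proof (rule sum.reindex_bij_witness[symmetric,
      where i = "\<lambda>(m, s). (s 1, contract (s 1) m, tl_seq n s)"
        and j = "\<lambda>(p, m, s). (insert_cap p m, cons_seq n p s)"], goal_cases)
    case (1 a)
    then show ?case by (auto simp: contract_insert_cap_same tl_cons_seq)
  next
    case (2 a)
    then show ?case
      by (auto intro!: insert_cap_ncm cons_seq_cap_seqs simp del: One_nat_def)
  next
    case (3 b)
    then obtain m s where b: "b = (m, s)" "m \<in> ncm (Suc n)" "s \<in> cap_seqs (Suc n) m" by auto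
    then show ?case
      using insert_cap_contract_cap[OF b(2) cap_seqs_first[OF b(2,3)]] tl_seq_cap_seqs(2)[OF b(2,3)] by simp
  next
    case (4 b)
    then obtain m s where b: "b = (m, s)" "m \<in> ncm (Suc n)" "s \<in> cap_seqs (Suc n) m" by auto
    then show ?case
      using contract_cap_ncm[OF b(2) cap_seqs_first[OF b(2,3)]] tl_seq_cap_seqs(1)[OF b(2,3)]
        cap_seqsD(1,2)[OF b(3), of 1] by simp
  next
    case (5 a)
    then show ?case by (auto simp: qint_seq_cons mult_ac)
  qed
  also have "\<dots> = (\<Sum>p = 1..Suc n. \<Sum>ms\<in>Sigma (ncm n) (cap_seqs n). ?g (p, ms))"
    by (simp only: sum.cartesian_product case_prod_eta)
  also have "\<dots> = (\<Sum>p = 1..Suc n. \<Sum>m\<in>ncm n. \<Sum>s\<in>cap_seqs n m. ?g (p, m, s))"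
    by (intro sum.cong refl) (subst sum.Sigma, auto simp: case_prod_unfold)
  also have "\<dots> = (\<Sum>p = 1..Suc n. qint (int p) * (\<Sum>m\<in>ncm n. weight n m * \<psi> (insert_cap p m)))"
    by (simp add: weight_def sum_distrib_right sum_distrib_left)
  finally show ?thesis .
qed

text \<open>The factor of the loop, if any, closed off by contracting \<open>i\<close> and \<open>i + 1\<close>; \<open>contract\<close> forgets it.\<close>

definition loop_factor :: "nat \<Rightarrow> (nat \<Rightarrow> nat) \<Rightarrow> ratfun" where
  "loop_factor i m = (if m i = Suc i then - qint 2 else 1)"

text \<open>
  Pairing with an arbitrary function \<open>\<phi>\<close>, rather than taking a single coefficient, lets the induction
  absorb the insertions into \<open>\<phi>\<close>.
\<close>

lemma weight_contract:
  assumes "1 \<le> i" "i < n"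
  shows "(\<Sum>m\<in>ncm n. weight n m * (loop_factor i m * \<phi> (contract i m))) = 0"
  using assms
proof (induction n arbitrary: i \<phi>)
  case (Suc n)
  define W where "W = (\<Sum>m\<in>ncm n. weight n m * \<phi> m)"
  define T where "T p = qint (int p) *
    (\<Sum>m\<in>ncm n. weight n m * (loop_factor i (insert_cap p m) * \<phi> (contract i (insert_cap p m))))" for p
  \<comment> \<open>The contraction closes the inserted cap into a loop.\<close>
  have same: "T i = qint (int i) * (- qint 2 * W)"
    by (simp add: T_def loop_factor_def contract_insert_cap_same W_def sum_distrib_left mult_ac)
  \<comment> \<open>A zigzag, as is the case \<open>p = i - 1\<close> below.\<close>
  have nxt: "T (Suc i) = qint (int (Suc i)) * W"
  proof -
    have "loop_factor i (insert_cap (Suc i) m) * \<phi> (contract i (insert_cap (Suc i) m)) = \<phi> m" if m: "m \<in> ncm n" for m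
    proof -
      have "m i \<noteq> i" using ncm_neq[OF m] Suc.prems by auto
      moreover have "insert_cap (Suc i) m i \<noteq> Suc i" using insert_cap_up[of "Suc i" m i] by (auto simp: up_def)
      ultimately show ?thesis
        using contract_insert_cap_Suc[OF ncm_invol[OF m]] by (simp add: loop_factor_def)
    qed
    then show ?thesis by (simp add: T_def W_def)
  qed
  \<comment> \<open>For \<open>i = 1\<close> there is no cap at position 0, but both sides vanish
    since \<open>[0] = 0\<close>.\<close>
  have prev: "T (i - 1) = qint (int (i - 1)) * W"
  proof (cases "i = 1")
    case False
    then obtain k where k: "i = Suc k" "1 \<le> k" using Suc.prems by (cases i) auto
    have "loop_factor i (insert_cap k m) * \<phi> (contract i (insert_cap k m)) = \<phi> m" if m: "m \<in> ncm n" for m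
    proof -
      have "m k \<noteq> k" using ncm_neq[OF m] Suc.prems k by auto
      then show ?thesis
        using contract_Suc_insert_cap[OF ncm_invol[OF m]] k by (simp add: loop_factor_def)
    qed
    then show ?thesis by (simp add: T_def W_def k)
  qed (simp add: T_def)
  \<comment> \<open>The contraction moves past the insertion, and the induction hypothesis applies
    to \<phi> composed with the insertion; likewise in \<open>below\<close>, where the contraction
    position drops by two.\<close>
  have above: "T p = 0" if p: "i + 2 \<le> p" "p \<le> Suc n" for p
  proof -
    obtain j where j: "p = j + 2" "i \<le> j" using p by (metis add.commute le_Suc_ex add_leD1 add_le_cancel_right ordered_cancel_comm_monoid_diff_class.diff_add)
    have "loop_factor i (insert_cap p m) * \<phi> (contract i (insert_cap p m)) = loop_factor i m * (\<phi> \<circ> insert_cap j) (contract i m)"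
      if m: "m \<in> ncm n" for m
    proof -
      have "m i \<noteq> i" "m (i + 1) \<noteq> i + 1" using ncm_neq[OF m] Suc.prems p by auto
      moreover have "insert_cap p m i = Suc i \<longleftrightarrow> m i = Suc i"
        using insert_cap_up[of p m i] p by (auto simp: up_def)
      ultimately show ?thesis
        using contract_insert_cap_ge[OF ncm_invol[OF m] j(2)] by (simp add: loop_factor_def j)
    qed
    then have "T p = qint (int p) *
      (\<Sum>m\<in>ncm n. weight n m * (loop_factor i m * (\<phi> \<circ> insert_cap j) (contract i m)))"
      by (simp add: T_def)
    also have "\<dots> = 0" using Suc.IH[of i "\<phi> \<circ> insert_cap j"] Suc.prems p by simp
    finally show ?thesis .
  qed
  have below: "T p = 0" if p: "p + 2 \<le> i" "1 \<le> p" for p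
  proof -
    obtain j where j: "i = j + 2" "p \<le> j" using p by (metis add_le_cancel_right add_leD2 ordered_cancel_comm_monoid_diff_class.diff_add)
    have "loop_factor i (insert_cap p m) * \<phi> (contract i (insert_cap p m)) = loop_factor j m * (\<phi> \<circ> insert_cap p) (contract j m)"
      if m: "m \<in> ncm n" for m
    proof -
      have "m j \<noteq> j" "m (j + 1) \<noteq> j + 1" using ncm_neq[OF m] Suc.prems p j by auto
      moreover have "insert_cap p m i = Suc i \<longleftrightarrow> m j = Suc j"
        using insert_cap_up[of p m j] p j by (auto simp: up_def)
      ultimately show ?thesis
        using contract_insert_cap_le[OF ncm_invol[OF m] j(2)] by (simp add: loop_factor_def j)
    qed
    then have "T p = qint (int p) *
      (\<Sum>m\<in>ncm n. weight n m * (loop_factor j m * (\<phi> \<circ> insert_cap p) (contract j m)))"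
      by (simp add: T_def)
    also have "\<dots> = 0" using Suc.IH[of j "\<phi> \<circ> insert_cap p"] Suc.prems p j by simp
    finally show ?thesis .
  qed
  have "(\<Sum>m\<in>ncm (Suc n). weight (Suc n) m * (loop_factor i m * \<phi> (contract i m))) = sum T {1..Suc n}"
    unfolding T_def by (rule weight_rec)
  \<comment> \<open>Adding the vanishing term at 0 lets \<open>i = 1\<close> be treated like every
    other \<open>i\<close>.\<close>
  also have "\<dots> = sum T {0..Suc n}"
  proof (rule sum.mono_neutral_left)
    show "\<forall>p\<in>{0..Suc n} - {1..Suc n}. T p = 0"
    proof
      fix p assume "p \<in> {0..Suc n} - {1..Suc n}"
      then have "p = 0" by auto
      then show "T p = 0" by (simp add: T_def)
    qed
  qed auto
  also have "\<dots> = sum T {i - 1, i, Suc i}"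
  proof (rule sum.mono_neutral_right)
    show "\<forall>p\<in>{0..Suc n} - {i - 1, i, Suc i}. T p = 0"
    proof
      fix p assume p: "p \<in> {0..Suc n} - {i - 1, i, Suc i}"
      then consider "p = 0" | "i + 2 \<le> p" | "p + 2 \<le> i" "1 \<le> p" by force
      then show "T p = 0"
        using p above below by cases (auto simp: T_def)
    qed
  qed (use Suc.prems in auto)
  also have "\<dots> = T (i - 1) + (T i + T (Suc i))"
    using Suc.prems by (subst sum.insert) auto
  also have "\<dots> = (qint (int i - 1) + qint (int i + 1) - qint 2 * qint (int i)) * W"
    unfolding same nxt prev using Suc.prems by (simp add: algebra_simps of_nat_diff)
  also have "\<dots> = 0" by (simp add: qint_rec)
  finally show ?case .
qed simp

lemma insert_cap_nest: "insert_cap (Suc n) (nest n) = nest (Suc n)"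
proof
  fix x show "insert_cap (Suc n) (nest n) x = nest (Suc n) x"
    by (auto simp: insert_cap_def nest_def up_def down_def)
qed

text \<open>The only neighbours joined in the nested matching are the two middle points. So with the
  indicator of that matching as \<psi>, the recursion keeps only \<open>p = Suc n\<close> and
  contributes one factor of \<open>[n]!\<close> per step.\<close>

lemma weight_nest: "weight n (nest n) = qfact n"
proof (induction n)
  case 0
  have "cap_seqs 0 (nest 0) = {\<lambda>_. undefined}" by (auto simp: cap_seqs_def)
  then show ?case by (simp add: weight_def qint_seq_def qfact_def)
next
  case (Suc n)
  have eq: "insert_cap p m = nest (Suc n) \<longleftrightarrow> p = Suc n \<and> m = nest n" if "p \<in> {1..Suc n}" for p m
  proof
    assume *: "insert_cap p m = nest (Suc n)"
    then have "nest (Suc n) p = Suc p" by (metis insert_cap_base(1))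
    then have "p = Suc n" using that by (auto simp: nest_def split: if_splits)
    then show "p = Suc n \<and> m = nest n" using * by (metis contract_insert_cap_same insert_cap_nest)
  qed (simp add: insert_cap_nest)
  let ?\<psi> = "\<lambda>m. if m = nest (Suc n) then 1 else 0 :: ratfun"
  have "weight (Suc n) (nest (Suc n)) = (\<Sum>m\<in>ncm (Suc n). weight (Suc n) m * ?\<psi> m)"
    using nest_ncm by (simp add: if_distrib cong: if_cong)
  also have "\<dots> = (\<Sum>p = 1..Suc n. qint (int p) * (\<Sum>m\<in>ncm n. weight n m * ?\<psi> (insert_cap p m)))"
    by (rule weight_rec)
  also have "\<dots> = (\<Sum>p = 1..Suc n. if p = Suc n then qint (int p) * weight n (nest n) else 0)"
  proof (rule sum.cong)
    fix p assume p: "p \<in> {1..Suc n}"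
    show "qint (int p) * (\<Sum>m\<in>ncm n. weight n m * ?\<psi> (insert_cap p m)) =
      (if p = Suc n then qint (int p) * weight n (nest n) else 0)"
      using nest_ncm by (simp add: eq[OF p] if_distrib cong: if_cong)
  qed simp
  also have "\<dots> = qint (int (Suc n)) * weight n (nest n)" by simp
  also have "\<dots> = qfact (Suc n)" by (simp add: Suc qfact_def)
  finally show ?case .
qed

lemma qfact_nonzero: "qfact n \<noteq> 0"
  by (auto simp: qfact_def qint_nonzero)

section \<open>Diagrams as matchings\<close>

text \<open>Matchings with crossings allowed, and \<open>pairings\<close> are the corresponding
  diagrams. Surgery on strands is done at this level, so planarity does not have to be carried
  along.\<close>

definition involutions :: "nat \<Rightarrow> (nat \<Rightarrow> nat) set" where
  "involutions n = {m. (\<forall>x. m (m x) = x) \<and> (\<forall>x. m x \<noteq> x \<longleftrightarrow> x \<in> {1..2 * n})}"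

definition pairings :: "nat \<Rightarrow> diagram set" where
  "pairings n = {D. partition_on (points n) D \<and> (\<forall>A\<in>D. card A = 2)}"

definition pt :: "nat \<Rightarrow> nat \<Rightarrow> point" where
  "pt n x = (if x \<le> n then Lower x else Upper (2 * n + 1 - x))"

definition diagram_of :: "nat \<Rightarrow> (nat \<Rightarrow> nat) \<Rightarrow> diagram" where
  "diagram_of n m = (\<lambda>x. {pt n x, pt n (m x)}) ` {1..2 * n}"

definition partner :: "nat \<Rightarrow> diagram \<Rightarrow> nat \<Rightarrow> nat" where
  "partner n D x = (if x \<in> {1..2 * n} then pos n (THE p. p \<noteq> pt n x \<and> {pt n x, p} \<in> D) else x)"

lemma involutionsD:
  assumes "m \<in> involutions n"
  shows "m (m x) = x" "m x \<noteq> x \<longleftrightarrow> x \<in> {1..2 * n}" "m x \<in> {1..2 * n} \<longleftrightarrow> x \<in> {1..2 * n}"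
    "m x = m y \<longleftrightarrow> x = y"
proof -
  show *: "m (m x) = x" "m x \<noteq> x \<longleftrightarrow> x \<in> {1..2 * n}" for x
    using assms unfolding involutions_def by blast+
  then show "m x \<in> {1..2 * n} \<longleftrightarrow> x \<in> {1..2 * n}" "m x = m y \<longleftrightarrow> x = y" by metis+
qed

lemma ncm_involutions: "m \<in> ncm n \<Longrightarrow> m \<in> involutions n"
  by (simp add: ncm_def involutions_def)

lemma insert_cap_contract_involutions:
  assumes m: "m \<in> involutions n" and i: "1 \<le> i" "i < 2 * n"
  shows "insert_cap i (contract i m) \<in> involutions n"
proof -
  note inv = involutionsD(1)[OF m]
  have ne: "m i \<noteq> i" "m (i + 1) \<noteq> i + 1" using involutionsD(2)[OF m] i by auto
  define s where "s = insert_cap i (contract i m)"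
  have s: "s x = (if x = i then i + 1 else if x = i + 1 then i else
      if m x = i then m (i + 1) else if m x = i + 1 then m i else m x)" for x
    using insert_cap_contract[OF inv ne] unfolding s_def reroute_def by simp
  have "s (s x) = x" for x
    unfolding s using inv ne by (smt (verit, ccfv_threshold))
  moreover have "s x \<noteq> x \<longleftrightarrow> x \<in> {1..2 * n}" for x
  proof (cases "x = i \<or> x = i + 1")
    case True
    then show ?thesis using i s by auto
  next
    case False
    have "m i = i + 1 \<longleftrightarrow> m (i + 1) = i" using inv by metis
    moreover have "m i \<in> {1..2 * n}" "m (i + 1) \<in> {1..2 * n}" using involutionsD(3)[OF m] i by auto
    moreover have "m x = i \<longleftrightarrow> x = m i" "m x = i + 1 \<longleftrightarrow> x = m (i + 1)" using inv by metis+
    moreover have "m i \<noteq> m (i + 1)" using inv by (metis add_cancel_right_right zero_neq_one)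
    ultimately show ?thesis using False involutionsD(2)[OF m, of x] unfolding s by auto
  qed
  ultimately show ?thesis unfolding s_def[symmetric] by (simp add: involutions_def)
qed

lemma pos_pt [simp]: "x \<in> {1..2 * n} \<Longrightarrow> pos n (pt n x) = x"
  by (auto simp: pt_def)

lemma pt_pos [simp]: "p \<in> points n \<Longrightarrow> pt n (pos n p) = p"
  by (auto simp: pt_def points_def)

lemma pos_range: "p \<in> points n \<Longrightarrow> pos n p \<in> {1..2 * n}"
  by (auto simp: points_def)

lemma pt_range [simp]:
  assumes "x \<in> {1..2 * n}"
  shows "pt n x \<in> points n"
proof -
  have "2 * n + 1 - x \<in> {1..n}" if "\<not> x \<le> n" using assms that by auto
  then show ?thesis using assms unfolding points_def pt_def by (auto simp del: One_nat_def)
qed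

lemma pt_eq_iff: "x \<in> {1..2 * n} \<Longrightarrow> y \<in> {1..2 * n} \<Longrightarrow> pt n x = pt n y \<longleftrightarrow> x = y"
  by (metis pos_pt)

lemma pt_image: "pt n ` {1..2 * n} = points n"
  using pt_pos pos_range by (metis (no_types, lifting) image_eqI image_subset_iff pt_range subsetI subset_antisym)

lemma pt_in_diagram_of:
  assumes m: "m \<in> involutions n" and xy: "x \<in> {1..2 * n}" "y \<in> {1..2 * n}"
  shows "{pt n x, pt n y} \<in> diagram_of n m \<longleftrightarrow> m x = y"
proof
  assume "{pt n x, pt n y} \<in> diagram_of n m"
  then obtain z where z: "z \<in> {1..2 * n}" "{pt n x, pt n y} = {pt n z, pt n (m z)}"
    by (auto simp: diagram_of_def)
  then have "m z \<in> {1..2 * n}" using involutionsD(3)[OF m] by simp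
  with z xy have "x = z \<and> y = m z \<or> x = m z \<and> y = z"
    by (auto simp: doubleton_eq_iff pt_eq_iff)
  then show "m x = y" using involutionsD(1)[OF m] by auto
qed (use xy in \<open>auto simp: diagram_of_def\<close>)

lemma diagram_of_pairings:
  assumes m: "m \<in> involutions n"
  shows "diagram_of n m \<in> pairings n"
proof -
  have r: "m x \<in> {1..2 * n}" if "x \<in> {1..2 * n}" for x using involutionsD(3)[OF m] that by simp
  have "\<Union> (diagram_of n m) = points n"
  proof
    show "\<Union> (diagram_of n m) \<subseteq> points n"
      using r pt_range by (fastforce simp: diagram_of_def)
    show "points n \<subseteq> \<Union> (diagram_of n m)"
      unfolding pt_image[symmetric] diagram_of_def by blast
  qed
  moreover have "disjnt A B" if AB: "A \<in> diagram_of n m" "B \<in> diagram_of n m" "A \<noteq> B" for A B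
  proof -
    obtain x y where xy: "x \<in> {1..2 * n}" "y \<in> {1..2 * n}"
      and A: "A = {pt n x, pt n (m x)}" and B: "B = {pt n y, pt n (m y)}"
      using AB(1,2) unfolding diagram_of_def by blast
    have "x \<noteq> y" "x \<noteq> m y" using AB(3) involutionsD(1)[OF m] unfolding A B by auto
    then have "m x \<noteq> y" using involutionsD(1)[OF m] by metis
    with \<open>x \<noteq> y\<close> \<open>x \<noteq> m y\<close> show ?thesis
      unfolding A B disjnt_def using xy r involutionsD(4)[OF m] by (auto simp: pt_eq_iff)
  qed
  moreover have "card A = 2" if A: "A \<in> diagram_of n m" for A
  proof -
    obtain x where x: "x \<in> {1..2 * n}" "A = {pt n x, pt n (m x)}"
      using A unfolding diagram_of_def by blast
    moreover have "m x \<noteq> x" using involutionsD(2)[OF m] x by blast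
    then have "pt n x \<noteq> pt n (m x)" using pt_eq_iff[OF x(1) r[OF x(1)]] by auto
    ultimately show ?thesis by simp
  qed
  ultimately show ?thesis
    unfolding pairings_def partition_on_def disjoint_def disjnt_def by fastforce
qed

lemma pairings_unique:
  assumes "D \<in> pairings n" "A \<in> D" "B \<in> D" "p \<in> A" "p \<in> B"
  shows "A = B"
  using assms unfolding pairings_def partition_on_def disjoint_def by blast

lemma pairings_partner:
  assumes D: "D \<in> pairings n" and p: "p \<in> points n"
  obtains p' where "p' \<in> points n" "p' \<noteq> p" "{p, p'} \<in> D"
    "\<And>r. {p, r} \<in> D \<Longrightarrow> r = p'"
proof -
  obtain A where A: "A \<in> D" "p \<in> A"
    using D p unfolding pairings_def partition_on_def by blast
  then have "card A = 2" "A \<subseteq> points n" using D unfolding pairings_def partition_on_def by blast+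
  with A(2) obtain p' where p': "A = {p, p'}" "p' \<noteq> p"
    by (metis card_2_iff insertE insert_commute singletonD)
  have "r = p'" if "{p, r} \<in> D" for r
  proof -
    have "{p, r} = {p, p'}" using pairings_unique[OF D that, of A p] A p' by simp
    then show ?thesis using p' by (auto simp: doubleton_eq_iff)
  qed
  moreover have "p' \<in> points n" "{p, p'} \<in> D" using p'(1) A(1) \<open>A \<subseteq> points n\<close> by auto
  ultimately show ?thesis using that p'(2) by blast
qed

lemma pairings_doubleton:
  assumes "D \<in> pairings n" "A \<in> D"
  obtains p p' where "A = {p, p'}" "p \<noteq> p'" "p \<in> points n" "p' \<in> points n"
proof -
  have "card A = 2" "A \<subseteq> points n" using assms unfolding pairings_def partition_on_def by blast+
  then show ?thesis using that by (auto simp: card_2_iff)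
qed

lemma partner_eq:
  assumes D: "D \<in> pairings n" and x: "x \<in> {1..2 * n}"
  shows "{pt n x, pt n (partner n D x)} \<in> D" "partner n D x \<in> {1..2 * n}" "partner n D x \<noteq> x"
    "\<And>y. y \<in> {1..2 * n} \<Longrightarrow> {pt n x, pt n y} \<in> D \<Longrightarrow> y = partner n D x"
proof -
  obtain p where p: "p \<in> points n" "p \<noteq> pt n x" "{pt n x, p} \<in> D"
    "\<And>r. {pt n x, r} \<in> D \<Longrightarrow> r = p"
    using pairings_partner[OF D pt_range[OF x]] by metis
  have "(THE r. r \<noteq> pt n x \<and> {pt n x, r} \<in> D) = p"
    by (rule the_equality) (use p(2,3) in simp, use p(4) in blast)
  then have eq: "partner n D x = pos n p"
    using x by (simp add: partner_def)
  show "{pt n x, pt n (partner n D x)} \<in> D" using p(1,3) by (simp add: eq)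
  show "partner n D x \<in> {1..2 * n}" unfolding eq using p(1) by (rule pos_range)
  show "partner n D x \<noteq> x" unfolding eq using p(1,2) pt_pos by metis
  fix y assume y: "y \<in> {1..2 * n}" "{pt n x, pt n y} \<in> D"
  show "y = partner n D x" unfolding eq using p(4)[OF y(2)] pos_pt[OF y(1)] by simp
qed

lemma partner_involutions:
  assumes D: "D \<in> pairings n"
  shows "partner n D \<in> involutions n"
proof -
  have "partner n D (partner n D x) = x" for x
  proof (cases "x \<in> {1..2 * n}")
    case True
    note p = partner_eq[OF D True]
    show ?thesis using partner_eq(4)[OF D p(2) True] p(1) by (simp add: insert_commute)
  qed (auto simp: partner_def)
  moreover have "partner n D x \<noteq> x \<longleftrightarrow> x \<in> {1..2 * n}" for x
    using partner_eq(3)[OF D, of x] by (cases "x \<in> {1..2 * n}") (auto simp: partner_def)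
  ultimately show ?thesis by (simp add: involutions_def)
qed

lemma diagram_of_partner:
  assumes D: "D \<in> pairings n"
  shows "diagram_of n (partner n D) = D"
proof
  show "diagram_of n (partner n D) \<subseteq> D" using partner_eq(1)[OF D] by (auto simp: diagram_of_def)
  show "D \<subseteq> diagram_of n (partner n D)"
  proof
    fix A assume A: "A \<in> D"
    then obtain p p' where p: "A = {p, p'}" "p \<noteq> p'" "p \<in> points n" "p' \<in> points n"
      using pairings_doubleton[OF D] by metis
    then obtain x y where xy: "x \<in> {1..2 * n}" "p = pt n x" "y \<in> {1..2 * n}" "p' = pt n y"
      by (metis pt_pos pos_range)
    then have "partner n D x = y" using partner_eq(4)[OF D xy(1,3)] A p by auto
    then show "A \<in> diagram_of n (partner n D)" using p xy by (auto simp: diagram_of_def)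
  qed
qed

lemma crossing_diagram_of:
  assumes m: "m \<in> involutions n"
  shows "(\<exists>A\<in>diagram_of n m. \<exists>B\<in>diagram_of n m. crossing n A B) \<longleftrightarrow>
    (\<exists>x y. x < y \<and> y < m x \<and> m x < m y)"
proof
  assume "\<exists>A\<in>diagram_of n m. \<exists>B\<in>diagram_of n m. crossing n A B"
  then obtain x y a b c d where xy: "x \<in> {1..2 * n}" "y \<in> {1..2 * n}"
    and abcd: "a \<in> {pt n x, pt n (m x)}" "c \<in> {pt n x, pt n (m x)}"
      "b \<in> {pt n y, pt n (m y)}" "d \<in> {pt n y, pt n (m y)}"
      "pos n a < pos n b" "pos n b < pos n c" "pos n c < pos n d"
    unfolding crossing_def diagram_of_def by blast
  have "m x \<in> {1..2 * n}" "m y \<in> {1..2 * n}" using involutionsD(3)[OF m] xy by auto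
  then have "pos n a \<in> {x, m x}" "pos n c \<in> {x, m x}" "pos n b \<in> {y, m y}" "pos n d \<in> {y, m y}"
    using abcd xy by auto
  \<comment> \<open>Each arc has only two points, and the strict inequalities separate
    \<open>a\<close> from \<open>c\<close> and \<open>b\<close> from \<open>d\<close>.\<close>
  then have "pos n c = m (pos n a)" "pos n d = m (pos n b)"
    using abcd(5-7) involutionsD(1)[OF m] by auto
  then show "\<exists>x y. x < y \<and> y < m x \<and> m x < m y" using abcd(5-7) by metis
next
  assume "\<exists>x y. x < y \<and> y < m x \<and> m x < m y"
  then obtain x y where *: "x < y" "y < m x" "m x < m y" by blast
  then have r: "x \<in> {1..2 * n}" "y \<in> {1..2 * n}" "m x \<in> {1..2 * n}" "m y \<in> {1..2 * n}"
    using involutionsD(2,3)[OF m, of x] involutionsD(2,3)[OF m, of y] by auto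
  then have "pos n (pt n x) < pos n (pt n y) \<and> pos n (pt n y) < pos n (pt n (m x)) \<and>
      pos n (pt n (m x)) < pos n (pt n (m y))"
    using * by simp
  then have "crossing n {pt n x, pt n (m x)} {pt n y, pt n (m y)}"
    unfolding crossing_def by blast
  then show "\<exists>A\<in>diagram_of n m. \<exists>B\<in>diagram_of n m. crossing n A B"
    using r(1,2) unfolding diagram_of_def by blast
qed

lemma diagram_of_eq_iff:
  assumes "m \<in> involutions n" "m' \<in> involutions n"
  shows "diagram_of n m = diagram_of n m' \<longleftrightarrow> m = m'"
proof
  assume eq: "diagram_of n m = diagram_of n m'"
  show "m = m'"
  proof
    fix x show "m x = m' x"
    proof (cases "x \<in> {1..2 * n}")
      case True
      then have "m x \<in> {1..2 * n}" using involutionsD(3)[OF assms(1)] by simp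
      then show ?thesis
        using pt_in_diagram_of[OF assms(1) True] pt_in_diagram_of[OF assms(2) True] eq by metis
    next
      case False
      then have "m x = x" "m' x = x" using involutionsD(2)[OF assms(1)] involutionsD(2)[OF assms(2)] by blast+
      then show ?thesis by simp
    qed
  qed
qed simp

lemma diagrams_pairings: "D \<in> diagrams n \<Longrightarrow> D \<in> pairings n"
  by (simp add: diagrams_def pairings_def)

lemma diagram_of_in_diagrams_iff:
  assumes "m \<in> involutions n"
  shows "diagram_of n m \<in> diagrams n \<longleftrightarrow> m \<in> ncm n"
  using diagram_of_pairings[OF assms] crossing_diagram_of[OF assms] assms
  unfolding diagrams_def pairings_def ncm_def involutions_def by blast

lemma bij_betw_diagram_of: "bij_betw (diagram_of n) (ncm n) (diagrams n)"
proof (rule bij_betwI')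
  show "\<And>D. D \<in> diagrams n \<Longrightarrow> \<exists>m\<in>ncm n. D = diagram_of n m"
    using diagram_of_partner partner_involutions diagrams_pairings diagram_of_in_diagrams_iff by metis
  show "diagram_of n x = diagram_of n y \<longleftrightarrow> x = y" if "x \<in> ncm n" "y \<in> ncm n" for x y
    using that by (intro diagram_of_eq_iff ncm_involutions)
  show "diagram_of n x \<in> diagrams n" if "x \<in> ncm n" for x
    using that diagram_of_in_diagrams_iff[OF ncm_involutions] by blast
qed

lemma index_set_diagram_of:
  assumes m: "m \<in> ncm n"
  shows "index_set n (diagram_of n m) = cap_seqs n m"
proof -
  note mi = ncm_involutions[OF m]
  have cf: "capform n (diagram_of n m) = (\<lambda>x. {x, m x}) ` {1..2 * n}"
    unfolding capform_def diagram_of_def image_image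
  proof (rule image_cong)
    fix x assume "x \<in> {1..2 * n}"
    then show "pos n ` {pt n x, pt n (m x)} = {x, m x}"
      using involutionsD(3)[OF mi, of x] by simp
  qed simp
  have cap: "l < r \<and> {l, r} \<in> capform n (diagram_of n m) \<longleftrightarrow> l < r \<and> r = m l" for l r
    unfolding cf using involutionsD(1)[OF mi] involutionsD(2)[OF mi, of l]
    by (auto simp: doubleton_eq_iff image_iff)
  have L: "left_ends n (diagram_of n m) = {x. x < m x}"
    unfolding left_ends_def cap by auto
  have R: "right_end n (diagram_of n m) l = m l" if "l < m l" for l
    unfolding right_end_def cap using that by (intro the_equality) auto
  show ?thesis
    unfolding index_set_def cap_seqs_def L by (auto simp: R)
qed

lemma finite_diagrams [simp]: "finite (diagrams n)"
  using bij_betw_finite[OF bij_betw_diagram_of] by simp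

section \<open>Stacking\<close>

text \<open>Connectivity for an arbitrary set of arcs. With the glued arcs for \<open>G\<close> and
  the middle line for \<open>M\<close>, \<open>comps G M\<close> below is the set of closed
  loops.\<close>

definition linked :: "'a set set \<Rightarrow> 'a rel" where
  "linked G = {(x, y). \<exists>a\<in>G. x \<in> a \<and> y \<in> a}\<^sup>*"

definition comps :: "'a set set \<Rightarrow> 'a set \<Rightarrow> 'a set set" where
  "comps G M = {C. \<exists>x\<in>M. C = linked G `` {x} \<and> C \<subseteq> M}"

lemma linked_refl [simp]: "(x, x) \<in> linked G"
  by (simp add: linked_def)

lemma linked_arc: "a \<in> G \<Longrightarrow> x \<in> a \<Longrightarrow> y \<in> a \<Longrightarrow> (x, y) \<in> linked G"
  unfolding linked_def by blast

lemma linked_trans: "(x, y) \<in> linked G \<Longrightarrow> (y, z) \<in> linked G \<Longrightarrow> (x, z) \<in> linked G"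
  unfolding linked_def by (rule rtrancl_trans)

lemma linked_sym: "(x, y) \<in> linked G \<Longrightarrow> (y, x) \<in> linked G"
  unfolding linked_def by (rule symD[OF sym_rtrancl]) (auto intro: symI)

lemma linked_class:
  assumes "(x, y) \<in> linked G"
  shows "linked G `` {x} = linked G `` {y}"
  using linked_trans[OF assms] linked_trans[OF linked_sym[OF assms]] by blast

lemma linked_map:
  assumes "(x, y) \<in> linked G"
    and "\<And>a x y. a \<in> G \<Longrightarrow> x \<in> a \<Longrightarrow> y \<in> a \<Longrightarrow> (f x, f y) \<in> linked G'"
  shows "(f x, f y) \<in> linked G'"
  using assms(1) unfolding linked_def[of G]
proof (induction rule: rtrancl_induct)
  case (step y z)
  then show ?case using assms(2) linked_trans by fastforce
qed simp

lemma linked_closed: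
  assumes "(x, y) \<in> linked G" "x \<in> S" and "\<And>a. a \<in> G \<Longrightarrow> a \<subseteq> S \<or> a \<inter> S = {}"
  shows "y \<in> S"
  using assms(1) unfolding linked_def
  by (induction rule: rtrancl_induct) (use assms(2,3) in auto)

text \<open>
  The graph \<open>G\<close> will be the one of a stack \<open>B D\<close>, where the cup \<open>{i, j}\<close> belongs to \<open>D\<close>, and
  \<open>G'\<close> the one of \<open>(B e\<^sub>i) D\<close>.
\<close>

locale arc_surgery =
  fixes G0 :: "'a set set" and a b i j :: 'a
  assumes fresh: "i \<notin> \<Union> G0" "j \<notin> \<Union> G0"
    and distinct: "i \<noteq> j" "a \<notin> {i, j}" "b \<notin> {i, j}"
begin

text \<open>In \<open>G\<close> a path runs from \<open>a\<close> through \<open>i\<close> and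
  \<open>j\<close> to \<open>b\<close>. In \<open>G'\<close> it is short-cut, and
  \<open>{i, j}\<close> is left behind as a component of its own.\<close>

definition G where "G = G0 \<union> {{i, j}, {i, a}, {j, b}}"
definition G' where "G' = G0 \<union> {{i, j}, {a, b}}"

lemma linked_iff:
  assumes "x \<notin> {i, j}" "y \<notin> {i, j}"
  shows "(x, y) \<in> linked G \<longleftrightarrow> (x, y) \<in> linked G'"
proof
  \<comment> \<open>Sliding \<open>i\<close> to \<open>a\<close> and \<open>j\<close> to
    \<open>b\<close> sends each of the three arcs of the detour into the arc \<open>{a, b}\<close>
    and fixes all others.\<close>
  define f where "f x = (if x = i then a else if x = j then b else x)" for x
  have ab: "(a, b) \<in> linked G'" by (rule linked_arc[of "{a, b}"]) (auto simp: G'_def)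
  have "(f x, f y) \<in> linked G'" if "(x, y) \<in> linked G"
    using that
  proof (rule linked_map)
    fix A x y assume A: "A \<in> G" "x \<in> A" "y \<in> A"
    show "(f x, f y) \<in> linked G'"
    proof (cases "A \<in> G0")
      case True
      then have "f x = x" "f y = y" using fresh A by (auto simp: f_def)
      then show ?thesis using linked_arc[of A G' x y] True A by (auto simp: G'_def)
    next
      case False
      then have "A \<in> {{i, j}, {i, a}, {j, b}}" using A(1) by (simp add: G_def)
      then have "f x \<in> {a, b}" "f y \<in> {a, b}"
        using A(2,3) distinct by (auto simp: f_def)
      then show ?thesis using ab linked_sym[OF ab] by auto
    qed
  qed
  then show "(x, y) \<in> linked G \<Longrightarrow> (x, y) \<in> linked G'"
    using assms by (simp add: f_def)
next
  have ij: "(i, j) \<in> linked G" by (rule linked_arc[of "{i, j}"]) (auto simp: G_def)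
  have ia: "(i, a) \<in> linked G" by (rule linked_arc[of "{i, a}"]) (auto simp: G_def)
  have jb: "(j, b) \<in> linked G" by (rule linked_arc[of "{j, b}"]) (auto simp: G_def)
  have ab: "(a, b) \<in> linked G"
    using linked_trans[OF linked_sym[OF ia] linked_trans[OF ij jb]] .
  assume "(x, y) \<in> linked G'"
  then show "(x, y) \<in> linked G"
  proof (rule linked_map[where f = "\<lambda>x. x"])
    fix A x y assume A: "A \<in> G'" "x \<in> A" "y \<in> A"
    show "(x, y) \<in> linked G"
    proof (cases "A \<in> {{i, j}, {a, b}}")
      case True
      then show ?thesis using A(2,3) ij ab linked_sym[OF ij] linked_sym[OF ab] by auto
    next
      case False
      then have "A \<in> G" using A(1) by (auto simp: G_def G'_def)
      then show ?thesis using A by (intro linked_arc)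
    qed
  qed
qed

lemma loop_class:
  assumes "x \<in> {i, j}"
  shows "linked G' `` {x} = {i, j}"
proof
  have cl: "A \<subseteq> {i, j} \<or> A \<inter> {i, j} = {}" if "A \<in> G'" for A
    using that fresh distinct by (auto simp: G'_def)
  show "linked G' `` {x} \<subseteq> {i, j}"
    using linked_closed[OF _ assms cl] by blast
  show "{i, j} \<subseteq> linked G' `` {x}"
    using linked_arc[of "{i, j}" G'] assms by (auto simp: G'_def)
qed

lemma class_diff:
  assumes "x \<notin> {i, j}"
  shows "linked G `` {x} - {i, j} = linked G' `` {x}"
proof (rule set_eqI)
  fix y
  show "y \<in> linked G `` {x} - {i, j} \<longleftrightarrow> y \<in> linked G' `` {x}"
  proof (cases "y \<in> {i, j}")
    case True
    then have "(x, y) \<notin> linked G'"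
      using loop_class[OF True] linked_sym assms by fastforce
    then show ?thesis using True by auto
  qed (use linked_iff[OF assms] in auto)
qed

text \<open>A component of \<open>G\<close> that meets \<open>{i, j}\<close> also contains
  \<open>a\<close> or \<open>b\<close>, so it survives the deletion of \<open>i\<close> and
  \<open>j\<close>. Deleting them is thus an injection into the components of \<open>G'\<close>,
  which misses only \<open>{i, j}\<close>.\<close>

lemma card_comps:
  assumes "finite M" "i \<in> M" "j \<in> M"
  shows "card (comps G' M) = Suc (card (comps G M))"
proof -
  have ia: "(i, a) \<in> linked G" by (rule linked_arc[of "{i, a}"]) (auto simp: G_def)
  have jb: "(j, b) \<in> linked G" by (rule linked_arc[of "{j, b}"]) (auto simp: G_def)
  have rep: "\<exists>x\<in>M. x \<notin> {i, j} \<and> C = linked G `` {x} \<and> C \<subseteq> M" if "C \<in> comps G M" for C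
  proof -
    obtain x where x: "x \<in> M" "C = linked G `` {x}" "C \<subseteq> M"
      using \<open>C \<in> comps G M\<close> by (auto simp: comps_def)
    consider "x = i" | "x = j" | "x \<notin> {i, j}" by blast
    then show ?thesis
    proof cases
      case 1
      then have "C = linked G `` {a}" "a \<in> C" using x linked_class[OF ia] ia by auto
      then show ?thesis using x distinct by blast
    next
      case 2
      then have "C = linked G `` {b}" "b \<in> C" using x linked_class[OF jb] jb by auto
      then show ?thesis using x distinct by blast
    qed (use x in blast)
  qed
  have "comps G' M = insert {i, j} ((\<lambda>C. C - {i, j}) ` comps G M)"
  proof (intro equalityI subsetI)
    fix C assume "C \<in> comps G' M"
    then obtain x where x: "x \<in> M" "C = linked G' `` {x}" "C \<subseteq> M" by (auto simp: comps_def)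
    show "C \<in> insert {i, j} ((\<lambda>C. C - {i, j}) ` comps G M)"
    proof (cases "x \<in> {i, j}")
      case True
      then show ?thesis using x loop_class by simp
    next
      case False
      note d = class_diff[OF False]
      then have "linked G `` {x} \<subseteq> M" using x assms by blast
      then have "linked G `` {x} \<in> comps G M" using x by (auto simp: comps_def)
      then show ?thesis using d x by blast
    qed
  next
    fix C assume "C \<in> insert {i, j} ((\<lambda>C. C - {i, j}) ` comps G M)"
    then consider "C = {i, j}" | C' where "C' \<in> comps G M" "C = C' - {i, j}" by blast
    then show "C \<in> comps G' M"
    proof cases
      case 1
      then show ?thesis using loop_class[of i] assms by (auto simp: comps_def)
    next
      case 2
      then obtain x where x: "x \<in> M" "x \<notin> {i, j}" "C' = linked G `` {x}" "C' \<subseteq> M"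
        using rep by blast
      then have "C = linked G' `` {x}" using 2 class_diff by simp
      moreover have "C \<subseteq> M" using 2 x by blast
      ultimately show ?thesis using x(1) unfolding comps_def by blast
    qed
  qed
  moreover have "inj_on (\<lambda>C. C - {i, j}) (comps G M)"
  proof (rule inj_onI)
    fix C D assume C: "C \<in> comps G M" and D: "D \<in> comps G M" and eq: "C - {i, j} = D - {i, j}"
    obtain x where x: "x \<notin> {i, j}" "C = linked G `` {x}" using rep[OF C] by blast
    obtain y where y: "y \<notin> {i, j}" "D = linked G `` {y}" using rep[OF D] by blast
    have "x \<in> C" using x by simp
    then have "x \<in> D" using eq x by blast
    then have "(y, x) \<in> linked G" using y by simp
    then show "C = D" using x y linked_class by metis
  qed
  moreover have "{i, j} \<notin> (\<lambda>C. C - {i, j}) ` comps G M" by blast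
  moreover have "finite (comps G M)"
    by (rule finite_subset[of _ "Pow M"]) (use assms in \<open>auto simp: comps_def\<close>)
  ultimately show ?thesis by (simp add: card_image)
qed

end

section \<open>Cutting and rejoining strands in a stack\<close>

lemma connected_sites_linked: "connected_sites A B = linked (glued_arcs A B)"
  by (simp add: connected_sites_def linked_def)

lemma loops_comps: "loops n A B = card (comps (glued_arcs A B) (Mid ` {1..n}))"
proof -
  have "{C. \<exists>j\<in>{1..n}. C = connected_sites A B `` {Mid j} \<and> C \<subseteq> Mid ` {1..n}} =
    comps (glued_arcs A B) (Mid ` {1..n})"
    unfolding comps_def connected_sites_linked by blast
  then show ?thesis by (simp add: loops_def)
qed

lemma upper_site_Mid: "upper_site p = Mid k \<longleftrightarrow> p = Lower k"
  and lower_site_Mid: "lower_site p = Mid k \<longleftrightarrow> p = Upper k"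
  by (cases p; simp)+

lemma Mid_in_upper_site: "Mid k \<in> upper_site ` A \<longleftrightarrow> Lower k \<in> A"
  by (metis image_iff upper_site_Mid)

lemma Mid_in_lower_site: "Mid k \<in> lower_site ` A \<longleftrightarrow> Upper k \<in> A"
  by (metis image_iff lower_site_Mid)

lemma outer_site_Mid [simp]: "outer_site p \<noteq> Mid k" "Mid k \<noteq> outer_site p"
  by (cases p; simp)+

text \<open>The diagram form of \<open>(B e\<^sub>i) D = - [2] B D\<close> for \<open>D\<close> with
  an upper cup at \<open>i\<close> and \<open>B\<close> without a lower cap there; \<open>E\<close>
  plays the part of \<open>B e\<^sub>i\<close>. Its short-cut bypasses the cup of \<open>D\<close>,
  which closes with the new cap of \<open>E\<close> to the additional loop.\<close>

lemma glue_surgery: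
  assumes B: "B \<in> pairings n" and D: "D \<in> pairings n" and i: "1 \<le> i" "i < n"
    and cap: "{Upper i, Upper (Suc i)} \<in> D"
    and a: "{Lower i, a} \<in> B" "a \<noteq> Lower (Suc i)" and b: "{Lower (Suc i), b} \<in> B"
    and E: "E = (B - {{Lower i, a}, {Lower (Suc i), b}}) \<union> {{Lower i, Lower (Suc i)}, {a, b}}"
  shows "stack n B D = stack n E D" "loops n E D = Suc (loops n B D)"
proof -
  define G0 where "G0 = image upper_site ` (B - {{Lower i, a}, {Lower (Suc i), b}}) \<union>
    image lower_site ` (D - {{Upper i, Upper (Suc i)}})"
  have ab: "a \<noteq> Lower i" "b \<noteq> Lower (Suc i)" "b \<noteq> Lower i"
    using pairings_doubleton[OF B a(1)] pairings_doubleton[OF B b]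
      pairings_unique[OF B a(1) b, of "Lower i"] a(2) by (auto simp: doubleton_eq_iff)
  interpret arc_surgery G0 "upper_site a" "upper_site b" "Mid i" "Mid (Suc i)"
  proof
    have "Lower i \<notin> A \<and> Lower (Suc i) \<notin> A" if "A \<in> B - {{Lower i, a}, {Lower (Suc i), b}}" for A
      using pairings_unique[OF B a(1), of A] pairings_unique[OF B b, of A] that by blast
    moreover have "Upper i \<notin> A \<and> Upper (Suc i) \<notin> A" if "A \<in> D - {{Upper i, Upper (Suc i)}}" for A
      using pairings_unique[OF D cap, of A] that by blast
    ultimately have "Mid i \<notin> C \<and> Mid (Suc i) \<notin> C" if "C \<in> G0" for C
      using that unfolding G0_def Un_iff image_iff[of C]
      by (elim disjE bexE) (simp_all only: Mid_in_upper_site Mid_in_lower_site simp_thms)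
    then show "Mid i \<notin> \<Union> G0" "Mid (Suc i) \<notin> \<Union> G0" by blast+
  qed (use ab a in \<open>auto simp: upper_site_Mid\<close>)
  have split: "image f ` C = image f ` (C - X) \<union> image f ` X" if "X \<subseteq> C"
    for f :: "point \<Rightarrow> site" and C X
    using that by blast
  have uB: "image upper_site ` B = image upper_site ` (B - {{Lower i, a}, {Lower (Suc i), b}}) \<union>
      {{Mid i, upper_site a}, {Mid (Suc i), upper_site b}}"
    using split[of "{{Lower i, a}, {Lower (Suc i), b}}" B upper_site] a b by simp
  have uE: "image upper_site ` E = image upper_site ` (B - {{Lower i, a}, {Lower (Suc i), b}}) \<union>
      {{Mid i, Mid (Suc i)}, {upper_site a, upper_site b}}"
    unfolding E image_Un by simp
  have lD: "image lower_site ` D = image lower_site ` (D - {{Upper i, Upper (Suc i)}}) \<union>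
      {{Mid i, Mid (Suc i)}}"
    using split[of "{{Upper i, Upper (Suc i)}}" D lower_site] cap by simp
  have gB: "glued_arcs B D = G"
    unfolding glued_arcs_def uB lD G_def unfolding G0_def by blast
  have gE: "glued_arcs E D = G'"
    unfolding glued_arcs_def uE lD G'_def unfolding G0_def by blast
  show "stack n B D = stack n E D"
    unfolding stack_def connected_sites_linked gB gE
    by (intro Collect_cong) (use linked_iff in auto)
  show "loops n E D = Suc (loops n B D)"
    unfolding loops_comps gB gE using i by (intro card_comps) auto
qed

section \<open>Stacking on the generators and on the identity\<close>

fun fold_site :: "site \<Rightarrow> point" where
  "fold_site (Top j) = Upper j"
| "fold_site (Mid j) = Lower j"
| "fold_site (Bot j) = Lower j"

text \<open>Treats the identity and the generators together. \<open>fold_site\<close> merges each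
  middle point with the bottom point below it; every glued arc then lies in one pair of
  \<open>E\<close>, so no path can leave that pair. Conversely, pairs of \<open>E\<close> are
  followed down along vertical strands, or reappear as caps of \<open>D\<close>. A component that
  contains a vertical strand reaches the bottom and is no loop.\<close>

lemma stack_through:
  assumes E: "E \<in> pairings n"
    and D: "D = caps \<union> {{Upper j, Lower j} | j. j \<in> {1..n} - K}"
    and caps: "\<And>A. A \<in> caps \<Longrightarrow> fold_site ` lower_site ` A \<in> E"
    and K: "\<And>k. k \<in> K \<Longrightarrow> \<exists>l. {Lower k, Lower l} \<in> E \<and> {Lower k, Lower l} \<in> caps"
  shows "stack n E D = E"
    and "k \<in> {1..n} - K \<Longrightarrow> \<not> linked (glued_arcs E D) `` {Mid k} \<subseteq> range Mid"
proof -
  let ?G = "glued_arcs E D"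
  have fu: "fold_site (upper_site p) = p" for p by (cases p) auto
  have fo: "fold_site (outer_site p) = p" for p by (cases p) auto
  have arc: "\<exists>A\<in>E. fold_site ` a \<subseteq> A" if a: "a \<in> ?G" for a
  proof -
    from a consider A where "A \<in> E" "a = upper_site ` A" | A where "A \<in> caps" "a = lower_site ` A"
      | j where "j \<in> {1..n}" "a = {Mid j, Bot j}"
      unfolding glued_arcs_def D by auto
    then show ?thesis
    proof cases
      case 1
      then show ?thesis by (auto simp: image_image fu intro: bexI[of _ A])
    next
      case 2
      then show ?thesis using caps by blast
    next
      case 3
      then have "Lower j \<in> points n" by (auto simp: points_def)
      then obtain p where "{Lower j, p} \<in> E" using pairings_partner[OF E] by metis
      then show ?thesis using 3 by (intro bexI[of _ "{Lower j, p}"]) auto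
    qed
  qed
  have same: "\<exists>A\<in>E. fold_site x \<in> A \<and> fold_site y \<in> A"
    if "(x, y) \<in> linked ?G" "x \<noteq> y" for x y
  proof -
    have "x = y \<or> (\<exists>A\<in>E. fold_site x \<in> A \<and> fold_site y \<in> A)"
      using that(1) unfolding linked_def
    proof (induction rule: rtrancl_induct)
      case (step y z)
      then obtain a where "a \<in> ?G" "y \<in> a" "z \<in> a" by auto
      then obtain A where A: "A \<in> E" "fold_site y \<in> A" "fold_site z \<in> A" using arc by blast
      then show ?case using step.IH pairings_unique[OF E] by metis
    qed simp
    then show ?thesis using that by simp
  qed
  have through: "(Mid k, Bot k) \<in> linked ?G" if "k \<in> {1..n} - K" for k
  proof (rule linked_arc)
    have "{Upper k, Lower k} \<in> D" using that unfolding D by blast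
    then have "lower_site ` {Upper k, Lower k} \<in> ?G" unfolding glued_arcs_def by blast
    then show "{Mid k, Bot k} \<in> ?G" by simp
  qed auto
  then show "k \<in> {1..n} - K \<Longrightarrow> \<not> linked ?G `` {Mid k} \<subseteq> range Mid" by auto
  have link: "(outer_site p, outer_site p') \<in> linked ?G" if pp: "{p, p'} \<in> E" for p p'
  proof (cases "\<exists>k\<in>K. p = Lower k \<or> p' = Lower k")
    case True
    then obtain k l where k: "{Lower k, Lower l} \<in> E" "{Lower k, Lower l} \<in> caps"
      "p = Lower k \<or> p' = Lower k" using K by blast
    then have "{p, p'} = {Lower k, Lower l}" using pairings_unique[OF E pp k(1)] by blast
    then have "{p, p'} \<in> D" "{p, p'} = {Lower k, Lower l}" using k unfolding D by auto
    then have "lower_site ` {Lower k, Lower l} \<in> ?G" unfolding glued_arcs_def by (metis UnI2 imageI)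
    then have *: "{Bot k, Bot l} \<in> ?G" by simp
    have "outer_site p \<in> {Bot k, Bot l}" "outer_site p' \<in> {Bot k, Bot l}"
      using \<open>{p, p'} = {Lower k, Lower l}\<close> by (auto simp: doubleton_eq_iff)
    with * show ?thesis by (rule linked_arc)
  next
    case False
    have pts: "p \<in> points n" "p' \<in> points n"
      using pp E unfolding pairings_def partition_on_def by blast+
    have *: "(outer_site r, upper_site r) \<in> linked ?G" if "r \<in> points n" "\<forall>k\<in>K. r \<noteq> Lower k" for r
    proof (cases r)
      case (Lower k)
      then have "k \<in> {1..n} - K" using that by (auto simp: points_def)
      then show ?thesis using linked_sym[OF through] Lower by simp
    qed simp
    have "upper_site ` {p, p'} \<in> ?G" using pp unfolding glued_arcs_def by blast
    then have mid: "(upper_site p, upper_site p') \<in> linked ?G" by (rule linked_arc) auto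
    have left: "(outer_site p, upper_site p) \<in> linked ?G"
      using *[OF pts(1)] False by simp
    have right: "(outer_site p', upper_site p') \<in> linked ?G"
      using *[OF pts(2)] False by simp
    show ?thesis using linked_trans[OF left linked_trans[OF mid linked_sym[OF right]]] .
  qed
  show "stack n E D = E"
  proof (intro equalityI subsetI)
    fix A assume "A \<in> stack n E D"
    then obtain x y where A: "A = {x, y}" "x \<noteq> y" "(outer_site x, outer_site y) \<in> linked ?G"
      unfolding stack_def connected_sites_linked by blast
    moreover have "outer_site x \<noteq> outer_site y" using A(2) fo by metis
    ultimately obtain A' where A': "A' \<in> E" "x \<in> A'" "y \<in> A'" using same fo by metis
    then obtain p p' where "A' = {p, p'}" using pairings_doubleton[OF E] by metis
    then have "A' = {x, y}" using A' A(2) by auto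
    then show "A \<in> E" using A A' by simp
  next
    fix A assume A: "A \<in> E"
    then obtain p p' where p: "A = {p, p'}" "p \<noteq> p'" "p \<in> points n" "p' \<in> points n"
      using pairings_doubleton[OF E] by metis
    then show "A \<in> stack n E D"
      using link A unfolding stack_def connected_sites_linked by blast
  qed
qed

text \<open>That is, \<open>E e\<^sub>i = - [2] E\<close>. The one loop consists of the lower cap of
  \<open>E\<close> and the upper cup of the generator; all other middle points are on vertical
  strands.\<close>

lemma stack_cup_cap:
  assumes E: "E \<in> pairings n" and i: "1 \<le> i" "i < n" and cap: "{Lower i, Lower (Suc i)} \<in> E"
  shows "stack n E (cup_cap n i) = E" "loops n E (cup_cap n i) = 1"
proof -
  let ?D = "cup_cap n i"
  let ?G = "glued_arcs E ?D"
  let ?caps = "{{Upper i, Upper (Suc i)}, {Lower i, Lower (Suc i)}}"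
  let ?K = "{i, Suc i}"
  have D: "?D = ?caps \<union> {{Upper j, Lower j} | j. j \<in> {1..n} - ?K}"
    by (simp add: cup_cap_def)
  have caps: "fold_site ` lower_site ` A \<in> E" if "A \<in> ?caps" for A
    using that cap by auto
  have K: "\<exists>l. {Lower k, Lower l} \<in> E \<and> {Lower k, Lower l} \<in> ?caps" if "k \<in> ?K" for k
    using that cap by (auto simp: insert_commute)
  note th = stack_through[OF E D caps K]
  show "stack n E ?D = E" by (rule th(1))
  have cl: "A \<subseteq> {Mid i, Mid (Suc i)} \<or> A \<inter> {Mid i, Mid (Suc i)} = {}" if "A \<in> ?G" for A
  proof -
    from that consider B where "B \<in> E" "A = upper_site ` B" | "A = {Mid i, Mid (Suc i)}"
      | "A = {Bot i, Bot (Suc i)}" | j where "j \<notin> ?K" "A = {Mid j, Bot j}"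
      unfolding glued_arcs_def D by auto
    then show ?thesis
    proof cases
      case 1
      show ?thesis
      proof (cases "B = {Lower i, Lower (Suc i)}")
        case False
        then have "Lower i \<notin> B" "Lower (Suc i) \<notin> B"
          using pairings_unique[OF E 1(1) cap] by blast+
        then have "Mid i \<notin> A" "Mid (Suc i) \<notin> A" unfolding 1(2) Mid_in_upper_site .
        then show ?thesis by blast
      qed (use 1 in simp)
    qed auto
  qed
  have "upper_site ` {Lower i, Lower (Suc i)} \<in> ?G"
    using cap unfolding glued_arcs_def by blast
  then have arc: "{Mid i, Mid (Suc i)} \<in> ?G" by simp
  have cls: "linked ?G `` {x} = {Mid i, Mid (Suc i)}" if x: "x \<in> {Mid i, Mid (Suc i)}" for x
  proof
    show "linked ?G `` {x} \<subseteq> {Mid i, Mid (Suc i)}"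
      using linked_closed[OF _ x cl] by blast
    show "{Mid i, Mid (Suc i)} \<subseteq> linked ?G `` {x}"
      using linked_arc[OF arc x] by blast
  qed
  have "comps ?G (Mid ` {1..n}) = {{Mid i, Mid (Suc i)}}"
  proof (intro equalityI subsetI)
    fix C assume "C \<in> comps ?G (Mid ` {1..n})"
    then obtain k where k: "k \<in> {1..n}" "C = linked ?G `` {Mid k}" "C \<subseteq> Mid ` {1..n}"
      by (auto simp: comps_def)
    then have "k \<in> ?K" using th(2)[of k] by blast
    then show "C \<in> {{Mid i, Mid (Suc i)}}" using cls[of "Mid k"] k by auto
  next
    fix C assume "C \<in> {{Mid i, Mid (Suc i)}}"
    then show "C \<in> comps ?G (Mid ` {1..n})"
      using cls[of "Mid i"] i by (auto simp: comps_def)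
  qed
  then show "loops n E ?D = 1" unfolding loops_comps by simp
qed

definition id_diagram :: "nat \<Rightarrow> diagram" where
  "id_diagram n = {{Upper j, Lower j} | j. j \<in> {1..n}}"

lemma stack_id:
  assumes E: "E \<in> pairings n"
  shows "stack n E (id_diagram n) = E" "loops n E (id_diagram n) = 0"
proof -
  have D: "id_diagram n = {} \<union> {{Upper j, Lower j} | j. j \<in> {1..n} - {}}"
    by (simp add: id_diagram_def)
  note th = stack_through[OF E D]
  show "stack n E (id_diagram n) = E" by (rule th(1)) auto
  have "\<not> linked (glued_arcs E (id_diagram n)) `` {Mid k} \<subseteq> range Mid" if "k \<in> {1..n}" for k
    by (rule th(2)) (use that in auto)
  then have "comps (glued_arcs E (id_diagram n)) (Mid ` {1..n}) = {}"
    by (auto simp: comps_def) blast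
  then show "loops n E (id_diagram n) = 0" unfolding loops_comps by simp
qed

section \<open>Reflection\<close>

fun flip :: "point \<Rightarrow> point" where
  "flip (Lower j) = Upper j"
| "flip (Upper j) = Lower j"

fun flip_site :: "site \<Rightarrow> site" where
  "flip_site (Top j) = Bot j"
| "flip_site (Mid j) = Mid j"
| "flip_site (Bot j) = Top j"

definition refl_diagram :: "diagram \<Rightarrow> diagram" where
  "refl_diagram D = image flip ` D"

lemma flip_flip [simp]: "flip (flip p) = p"
  by (cases p) auto

lemma flip_site_flip_site [simp]: "flip_site (flip_site p) = p"
  by (cases p) auto

lemma flip_points [simp]: "flip p \<in> points n \<longleftrightarrow> p \<in> points n"
  by (cases p) (auto simp: points_def)

lemma refl_refl [simp]: "refl_diagram (refl_diagram D) = D"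
  by (simp add: refl_diagram_def image_image)

lemma glued_arcs_refl:
  "glued_arcs (refl_diagram B) (refl_diagram A) = image flip_site ` glued_arcs A B"
proof -
  have *: "upper_site (flip p) = flip_site (lower_site p)" "lower_site (flip p) = flip_site (upper_site p)" for p
    by (cases p; simp)+
  show ?thesis
    unfolding glued_arcs_def refl_diagram_def image_Un image_image * by (rule Un_commute)
qed

lemma linked_image:
  assumes "\<And>x. f (f x) = x"
  shows "(f x, f y) \<in> linked (image f ` G) \<longleftrightarrow> (x, y) \<in> linked G"
proof
  have *: "(f x, f y) \<in> linked (image f ` G)" if "(x, y) \<in> linked G" for x y G
    using that by (rule linked_map) (auto intro: linked_arc[of "f ` _"])
  then show "(x, y) \<in> linked G \<Longrightarrow> (f x, f y) \<in> linked (image f ` G)" .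
  assume "(f x, f y) \<in> linked (image f ` G)"
  from *[OF this] show "(x, y) \<in> linked G" by (simp add: image_image assms)
qed

text \<open>The inclusion \<open>sub\<close> is proved for arbitrary factors; applied to the
  reflected ones and reflected back, it gives the converse.\<close>

lemma stack_refl: "stack n (refl_diagram B) (refl_diagram A) = refl_diagram (stack n A B)"
proof -
  have o: "outer_site (flip p) = flip_site (outer_site p)" for p by (cases p) auto
  have iff: "(outer_site (flip x), outer_site (flip y)) \<in> connected_sites (refl_diagram B) (refl_diagram A)
    \<longleftrightarrow> (outer_site x, outer_site y) \<in> connected_sites A B" for x y A B
    unfolding connected_sites_linked glued_arcs_refl o by (rule linked_image) simp
  have sub: "refl_diagram (stack n A B) \<subseteq> stack n (refl_diagram B) (refl_diagram A)" for A B
  proof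
    fix C assume "C \<in> refl_diagram (stack n A B)"
    then obtain x y where C: "C = flip ` {x, y}" "x \<in> points n" "y \<in> points n" "x \<noteq> y"
      "(outer_site x, outer_site y) \<in> connected_sites A B"
      unfolding refl_diagram_def stack_def by blast
    then have "flip x \<noteq> flip y" by (metis flip_flip)
    then show "C \<in> stack n (refl_diagram B) (refl_diagram A)"
      using C iff[of x y B A] unfolding stack_def mem_Collect_eq
      by (intro exI[of _ "flip x"] exI[of _ "flip y"]) simp
  qed
  have "refl_diagram (stack n (refl_diagram B) (refl_diagram A)) \<subseteq> stack n A B"
    using sub[of "refl_diagram B" "refl_diagram A"] by simp
  then have "refl_diagram (refl_diagram (stack n (refl_diagram B) (refl_diagram A))) \<subseteq>
    refl_diagram (stack n A B)"
    unfolding refl_diagram_def by blast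
  then show ?thesis using sub[of A B] by auto
qed

lemma loops_refl: "loops n (refl_diagram B) (refl_diagram A) = loops n A B"
proof -
  have eq: "linked (image flip_site ` G) `` {Mid k} = flip_site ` (linked G `` {Mid k})" for G k
  proof (rule set_eqI)
    fix y
    have "(Mid k, y) \<in> linked (image flip_site ` G) \<longleftrightarrow> (Mid k, flip_site y) \<in> linked G"
      using linked_image[of flip_site "Mid k" "flip_site y" G] by simp
    moreover have "y \<in> flip_site ` S \<longleftrightarrow> flip_site y \<in> S" for S
      by (metis flip_site_flip_site imageE imageI)
    ultimately show "y \<in> linked (image flip_site ` G) `` {Mid k} \<longleftrightarrow> y \<in> flip_site ` (linked G `` {Mid k})"
      by (simp add: Image_singleton_iff)
  qed
  \<comment> \<open>The middle line is fixed pointwise, so reflection changes no closed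
    loop.\<close>
  have fix_eq: "flip_site ` C = C" if "C \<subseteq> Mid ` {1..n} \<or> flip_site ` C \<subseteq> Mid ` {1..n}" for C
  proof -
    have "flip_site x = x" if "x \<in> C" for x
      using \<open>C \<subseteq> Mid ` {1..n} \<or> flip_site ` C \<subseteq> Mid ` {1..n}\<close> that by (cases x) auto
    then show ?thesis by simp
  qed
  have "comps (image flip_site ` G) (Mid ` {1..n}) = comps G (Mid ` {1..n})" for G
  proof -
    have *: "C = flip_site ` K \<and> C \<subseteq> Mid ` {1..n} \<longleftrightarrow> C = K \<and> C \<subseteq> Mid ` {1..n}" for C K
      using fix_eq[of K] by auto
    show ?thesis
      unfolding comps_def
    proof (intro Collect_cong bex_cong refl)
      fix C x assume "x \<in> Mid ` {1..n}"
      then obtain k where "x = Mid k" by blast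
      then show "C = linked (image flip_site ` G) `` {x} \<and> C \<subseteq> Mid ` {1..n} \<longleftrightarrow>
        C = linked G `` {x} \<and> C \<subseteq> Mid ` {1..n}"
        using *[of C "linked G `` {Mid k}"] by (simp only: eq)
    qed
  qed
  then show ?thesis unfolding loops_comps glued_arcs_refl by simp
qed

lemma pos_flip: "p \<in> points n \<Longrightarrow> pos n (flip p) = 2 * n + 1 - pos n p"
  by (cases p) (auto simp: points_def)

lemma refl_pairings:
  assumes "D \<in> pairings n"
  shows "refl_diagram D \<in> pairings n"
proof -
  have inj: "inj flip" by (metis flip_flip injI)
  have part: "\<Union> D = points n" "\<And>A B. A \<in> D \<Longrightarrow> B \<in> D \<Longrightarrow> A \<noteq> B \<Longrightarrow> A \<inter> B = {}" "{} \<notin> D"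
    "\<And>A. A \<in> D \<Longrightarrow> card A = 2"
    using assms unfolding pairings_def partition_on_def disjoint_def by auto
  have "\<Union> (refl_diagram D) = flip ` points n"
    unfolding refl_diagram_def part(1)[symmetric] by blast
  also have "\<dots> = points n" by (auto simp: image_iff) (metis flip_flip flip_points)
  finally show ?thesis
    using part(2-4) inj unfolding pairings_def partition_on_def disjoint_def refl_diagram_def
    by (auto simp: card_image inj_on_subset image_Int[symmetric] simp flip: image_Int)
qed

lemma refl_diagrams:
  assumes D: "D \<in> diagrams n"
  shows "refl_diagram D \<in> diagrams n"
proof -
  have p: "D \<in> pairings n" using D by (rule diagrams_pairings)
  have "\<not> crossing n (flip ` A) (flip ` B)" if AB: "A \<in> D" "B \<in> D" for A B
  proof
    have sub: "A \<subseteq> points n" "B \<subseteq> points n"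
      using AB p unfolding pairings_def partition_on_def by blast+
    assume "crossing n (flip ` A) (flip ` B)"
    then obtain a b c d where *: "a \<in> A" "b \<in> B" "c \<in> A" "d \<in> B"
      "pos n (flip a) < pos n (flip b)" "pos n (flip b) < pos n (flip c)"
      "pos n (flip c) < pos n (flip d)"
      unfolding crossing_def by blast
    have pts: "a \<in> points n" "b \<in> points n" "c \<in> points n" "d \<in> points n" using * sub by auto
    \<comment> \<open>Reflection reverses the boundary order, so the two arcs still interleave, with
      their roles exchanged.\<close>
    have "pos n d < pos n c" "pos n c < pos n b" "pos n b < pos n a"
      using *(5-7) pts by (simp_all add: pos_flip)
    then have "crossing n B A" unfolding crossing_def using * by blast
    then show False using D AB unfolding diagrams_def by blast
  qed
  then show ?thesis
    using refl_pairings[OF p] unfolding diagrams_def pairings_def refl_diagram_def by blast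
qed

lemma refl_through: "image flip ` {{Upper j, Lower j} | j. j \<in> K} = {{Upper j, Lower j} | j. j \<in> K}"
  unfolding Setcompr_eq_image image_image by (simp add: insert_commute)

lemma refl_id: "refl_diagram (id_diagram n) = id_diagram n"
  unfolding refl_diagram_def id_diagram_def by (rule refl_through)

lemma refl_cup_cap: "refl_diagram (cup_cap n i) = cup_cap n i"
  unfolding refl_diagram_def cup_cap_def image_Un refl_through by auto

section \<open>The identity and the generators\<close>

lemma diagram_of_nest: "diagram_of n (nest n) = id_diagram n"
proof
  show "diagram_of n (nest n) \<subseteq> id_diagram n"
  proof
    fix A assume "A \<in> diagram_of n (nest n)"
    then obtain x where x: "x \<in> {1..2 * n}" "A = {pt n x, pt n (2 * n + 1 - x)}"
      unfolding diagram_of_def nest_def by auto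
    show "A \<in> id_diagram n"
    proof (cases "x \<le> n")
      case True
      then have "A = {Upper x, Lower x}" using x by (auto simp: pt_def)
      then show ?thesis using True x unfolding id_diagram_def by auto
    next
      case False
      then have "A = {Upper (2 * n + 1 - x), Lower (2 * n + 1 - x)}" using x by (auto simp: pt_def)
      moreover have "2 * n + 1 - x \<in> {1..n}" using False x by auto
      ultimately show ?thesis unfolding id_diagram_def by blast
    qed
  qed
  show "id_diagram n \<subseteq> diagram_of n (nest n)"
  proof
    fix A assume "A \<in> id_diagram n"
    then obtain j where j: "j \<in> {1..n}" "A = {Upper j, Lower j}" unfolding id_diagram_def by blast
    then have "A = {pt n j, pt n (nest n j)}" by (auto simp: pt_def nest_def)
    moreover have "j \<in> {1..2 * n}" using j by auto
    ultimately show "A \<in> diagram_of n (nest n)" unfolding diagram_of_def by blast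
  qed
qed

lemma id_diagrams: "id_diagram n \<in> diagrams n"
  using diagram_of_in_diagrams_iff[OF ncm_involutions[OF nest_ncm]] nest_ncm unfolding diagram_of_nest by blast

text \<open>\<open>ncm_nest_or_cap\<close> read on the upper edge, where position
  \<open>2 * n - i\<close> is the point \<open>Upper (Suc i)\<close>.\<close>

lemma diagram_id_or_upper_cap:
  assumes D: "D \<in> diagrams n" and "D \<noteq> id_diagram n"
  shows "\<exists>i. 1 \<le> i \<and> i < n \<and> {Upper i, Upper (Suc i)} \<in> D"
proof -
  obtain m where m: "m \<in> ncm n" "D = diagram_of n m"
    using bij_betw_imp_surj_on[OF bij_betw_diagram_of] D by blast
  then have "m \<noteq> nest n" using assms diagram_of_nest by auto
  then obtain i where i: "1 \<le> i" "i < n" "m (2 * n - i) = Suc (2 * n - i)"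
    using ncm_nest_or_cap[OF m(1)] by blast
  then have "{pt n (2 * n - i), pt n (Suc (2 * n - i))} \<in> D"
    unfolding m(2) by (subst pt_in_diagram_of[OF ncm_involutions[OF m(1)]]) auto
  moreover have "pt n (2 * n - i) = Upper (Suc i)" "pt n (Suc (2 * n - i)) = Upper i"
    using i by (auto simp: pt_def)
  ultimately show ?thesis using i by (auto simp: insert_commute)
qed

text \<open>Planarity is inherited from insertion: the generator is the nested matching on
  \<open>n - 2\<close> strands with caps inserted first at \<open>i\<close> and then at
  \<open>2 * n - i\<close>.\<close>

lemma cup_cap_diagrams:
  assumes i: "1 \<le> i" "i < n"
  shows "cup_cap n i \<in> diagrams n"
proof -
  obtain k where k: "n = k + 2" using that[of "n - 2"] i by simp
  define m where "m = insert_cap (2 * n - i) (insert_cap i (nest k))"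
  have ins: "insert_cap i (nest k) \<in> ncm (Suc k)" using i k by (intro insert_cap_ncm nest_ncm) auto
  have "m \<in> ncm (Suc (Suc k))" unfolding m_def using i k by (intro insert_cap_ncm[OF ins]) auto
  then have m: "m \<in> ncm n" using k by simp
  have m_i: "m i = Suc i" "m (2 * n - i) = Suc (2 * n - i)"
    using i by (auto simp: m_def insert_cap_def up_def down_def)
  have m_j: "m j = 2 * n + 1 - j" if j: "j \<in> {1..n}" "j \<noteq> i" "j \<noteq> Suc i" for j
  proof (cases "j < i")
    case True
    then show ?thesis using i j k by (auto simp: m_def insert_cap_def up_def down_def nest_def)
  next
    case False
    then have "Suc i < j" using j by simp
    then show ?thesis using i j k by (auto simp: m_def insert_cap_def up_def down_def nest_def)
  qed
  have "diagram_of n m = cup_cap n i"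
  proof (rule equalityI)
    show sub: "cup_cap n i \<subseteq> diagram_of n m"
    proof
      fix A assume "A \<in> cup_cap n i"
      then consider "A = {Upper i, Upper (Suc i)}" | "A = {Lower i, Lower (Suc i)}"
        | j where "j \<in> {1..n}" "j \<noteq> i" "j \<noteq> Suc i" "A = {Upper j, Lower j}"
        unfolding cup_cap_def by auto
      then show "A \<in> diagram_of n m"
      proof cases
        case 1
        then have "A = {pt n (2 * n - i), pt n (m (2 * n - i))}" using i by (auto simp: m_i pt_def)
        moreover have "2 * n - i \<in> {1..2 * n}" using i by auto
        ultimately show ?thesis unfolding diagram_of_def by blast
      next
        case 2
        then have "A = {pt n i, pt n (m i)}" using i by (auto simp: m_i pt_def)
        moreover have "i \<in> {1..2 * n}" using i by auto
        ultimately show ?thesis unfolding diagram_of_def by blast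
      next
        case 3
        then have "A = {pt n j, pt n (m j)}" using i by (auto simp: m_j pt_def)
        moreover have "j \<in> {1..2 * n}" using 3 by auto
        ultimately show ?thesis unfolding diagram_of_def by blast
      qed
    qed
    \<comment> \<open>Each pair shares a point with a pair of the generator, which is already known
      to be in \<open>diagram_of n m\<close>; blocks of a partition that meet are equal.\<close>
    show "diagram_of n m \<subseteq> cup_cap n i"
    proof
      fix A assume A: "A \<in> diagram_of n m"
      then obtain p where p: "p \<in> A" "p \<in> points n"
        using pairings_doubleton[OF diagram_of_pairings[OF ncm_involutions[OF m]]] by blast
      then obtain j where j: "j \<in> {1..n}" "p = Lower j \<or> p = Upper j"
        unfolding points_def by blast
      have "\<exists>B\<in>cup_cap n i. p \<in> B"
      proof (cases "j = i \<or> j = Suc i")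
        case True
        then show ?thesis using j(2) unfolding cup_cap_def by auto
      next
        case False
        then have "{Upper j, Lower j} \<in> cup_cap n i" using j(1) unfolding cup_cap_def by auto
        then show ?thesis using j(2) by blast
      qed
      then show "A \<in> cup_cap n i"
        using sub pairings_unique[OF diagram_of_pairings[OF ncm_involutions[OF m]] A _ p(1)] by blast
    qed
  qed
  then show ?thesis using diagram_of_in_diagrams_iff[OF ncm_involutions[OF m]] m by simp
qed

text \<open>The bridge from stacking to matchings. If \<open>m i = Suc i\<close>, the diagram
  absorbs the generator with one loop. Otherwise surgery on it gives a diagram \<open>E\<close>, and
  \<open>glue_surgery\<close> with the generator itself as \<open>D\<close> compares the two stacks:
  since \<open>E\<close> absorbs the generator with one loop, the original diagram goes to
  \<open>E\<close> with none.\<close>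

lemma stack_cup_cap_diagram_of:
  assumes m: "m \<in> ncm n" and i: "1 \<le> i" "i < n"
  shows "stack n (diagram_of n m) (cup_cap n i) = diagram_of n (insert_cap i (contract i m))"
    "loops n (diagram_of n m) (cup_cap n i) = (if m i = Suc i then 1 else 0)"
    "\<And>D. D \<in> pairings n \<Longrightarrow> {Upper i, Upper (Suc i)} \<in> D \<Longrightarrow>
      stack n (diagram_of n (insert_cap i (contract i m))) D = stack n (diagram_of n m) D \<and>
      loops n (diagram_of n (insert_cap i (contract i m))) D + loops n (diagram_of n m) (cup_cap n i) = Suc (loops n (diagram_of n m) D)"
proof -
  note mi = ncm_involutions[OF m]
  define E where "E = diagram_of n (insert_cap i (contract i m))"
  have inv: "insert_cap i (contract i m) \<in> involutions n" using insert_cap_contract_involutions[OF mi] i by simp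
  have B: "diagram_of n m \<in> pairings n" by (rule diagram_of_pairings[OF mi])
  have E: "E \<in> pairings n" unfolding E_def by (rule diagram_of_pairings[OF inv])
  have r: "i \<in> {1..2 * n}" "Suc i \<in> {1..2 * n}" using i by auto
  have pti: "pt n i = Lower i" "pt n (Suc i) = Lower (Suc i)" using i by (auto simp: pt_def)
  have capE: "{Lower i, Lower (Suc i)} \<in> E"
    using pt_in_diagram_of[OF inv r] unfolding E_def pti by simp
  have capE_D: "cup_cap n i \<in> pairings n" "{Upper i, Upper (Suc i)} \<in> cup_cap n i"
    using diagrams_pairings[OF cup_cap_diagrams[OF i]] by (auto simp: cup_cap_def)
  note SE = stack_cup_cap[OF E i capE]
  have "stack n (diagram_of n m) (cup_cap n i) = E \<and>
    loops n (diagram_of n m) (cup_cap n i) = (if m i = Suc i then 1 else 0) \<and>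
    (\<forall>D. D \<in> pairings n \<longrightarrow> {Upper i, Upper (Suc i)} \<in> D \<longrightarrow>
      stack n E D = stack n (diagram_of n m) D \<and>
      loops n E D + loops n (diagram_of n m) (cup_cap n i) = Suc (loops n (diagram_of n m) D))"
  proof (cases "m i = Suc i")
    case True
    then have "E = diagram_of n m" unfolding E_def using insert_cap_contract_cap[OF m] by simp
    then show ?thesis using SE True by simp
  next
    case False
    have ne: "m i \<noteq> i" "m (i + 1) \<noteq> i + 1" using involutionsD(2)[OF mi] r by auto
    have ins: "insert_cap i (contract i m) x = (if x = i then i + 1 else if x = i + 1 then i else reroute i m x)" for x
      using insert_cap_contract[OF involutionsD(1)[OF mi] ne] .
    have False': "m (Suc i) \<noteq> i" using False involutionsD(1)[OF mi] by metis
    let ?a = "pt n (m i)" and ?b = "pt n (m (Suc i))"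
    have mr: "m i \<in> {1..2 * n}" "m (Suc i) \<in> {1..2 * n}" using r involutionsD(3)[OF mi] by auto
    have aB: "{Lower i, ?a} \<in> diagram_of n m" "{Lower (Suc i), ?b} \<in> diagram_of n m"
      using pt_in_diagram_of[OF mi r(1) mr(1)] pt_in_diagram_of[OF mi r(2) mr(2)] unfolding pti by simp_all
    have a: "?a \<noteq> Lower (Suc i)" using False pt_eq_iff[OF mr(1) r(2)] unfolding pti by simp
    have abE: "{?a, ?b} \<in> E"
    proof -
      have "insert_cap i (contract i m) (m i) = m (Suc i)"
        using False ne involutionsD(1)[OF mi, of i] by (simp add: ins reroute_def)
      then show ?thesis using pt_in_diagram_of[OF inv mr] unfolding E_def by simp
    qed
    have "E = (diagram_of n m - {{Lower i, ?a}, {Lower (Suc i), ?b}}) \<union> {{Lower i, Lower (Suc i)}, {?a, ?b}}"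
      (is "E = ?R")
    proof (rule equalityI)
      have sub: "?R \<subseteq> E"
      proof
        fix A assume "A \<in> ?R"
        then consider "A \<in> {{Lower i, Lower (Suc i)}, {?a, ?b}}"
          | "A \<in> diagram_of n m" "A \<noteq> {Lower i, ?a}" "A \<noteq> {Lower (Suc i), ?b}" by blast
        then show "A \<in> E"
        proof cases
          case 2
          then obtain x where x: "x \<in> {1..2 * n}" "A = {pt n x, pt n (m x)}" unfolding diagram_of_def by blast
          have "x \<noteq> i" "x \<noteq> Suc i" using 2 x pti by auto
          moreover have "m x \<noteq> i"
          proof
            assume "m x = i"
            then have "x = m i" using involutionsD(1)[OF mi, of x] by simp
            then show False using 2 x pti \<open>m x = i\<close> by (auto simp: insert_commute)
          qed
          moreover have "m x \<noteq> Suc i"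
          proof
            assume "m x = Suc i"
            then have "x = m (Suc i)" using involutionsD(1)[OF mi, of x] by simp
            then show False using 2 x pti \<open>m x = Suc i\<close> by (auto simp: insert_commute)
          qed
          ultimately have "insert_cap i (contract i m) x = m x" by (simp add: ins reroute_def)
          then show ?thesis using x unfolding E_def diagram_of_def by force
        qed (use capE abE in auto)
      qed
      show "?R \<subseteq> E" by (rule sub)
      show "E \<subseteq> ?R"
      proof
        fix A assume A: "A \<in> E"
        then obtain p where p: "p \<in> A" "p \<in> points n"
          using pairings_doubleton[OF E] by blast
        obtain p' where p': "{p, p'} \<in> diagram_of n m" using pairings_partner[OF B p(2)] by metis
        obtain C where C: "C \<in> ?R" "p \<in> C"
        proof (cases "{p, p'} \<in> {{Lower i, ?a}, {Lower (Suc i), ?b}}")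
          case True
          then have "p \<in> {Lower i, Lower (Suc i)} \<or> p \<in> {?a, ?b}"
            by (auto simp: doubleton_eq_iff)
          then show ?thesis using that by (metis UnI2 insertI1 insertI2)
        next
          case False
          then have "{p, p'} \<in> ?R" using p' by simp
          then show ?thesis using that by (metis insertI1)
        qed
        have "A = C" by (rule pairings_unique[OF E A subsetD[OF sub C(1)] p(1) C(2)])
        then show "A \<in> ?R" using C(1) by (rule ssubst)
      qed
    qed
    note S = glue_surgery[OF B _ i _ aB(1) a aB(2) this]
    show ?thesis using S[OF capE_D] SE False S by auto
  qed
  then show "stack n (diagram_of n m) (cup_cap n i) = diagram_of n (insert_cap i (contract i m))"
    "loops n (diagram_of n m) (cup_cap n i) = (if m i = Suc i then 1 else 0)"
    "\<And>D. D \<in> pairings n \<Longrightarrow> {Upper i, Upper (Suc i)} \<in> D \<Longrightarrow>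
      stack n (diagram_of n (insert_cap i (contract i m))) D = stack n (diagram_of n m) D \<and>
      loops n (diagram_of n (insert_cap i (contract i m))) D + loops n (diagram_of n m) (cup_cap n i) = Suc (loops n (diagram_of n m) D)"
    unfolding E_def by blast+
qed

section \<open>Uniqueness of the Jones-Wenzl idempotent\<close>

lemma tl_mult_alt:
  "tl_mult n x y E = (\<Sum>B\<in>diagrams n. y B * (\<Sum>A\<in>diagrams n.
     x A * ((- qint 2) ^ loops n A B * (if stack n A B = E then 1 else 0))))"
proof -
  have "tl_mult n x y E = (\<Sum>(A, B)\<in>{p \<in> diagrams n \<times> diagrams n. stack n (fst p) (snd p) = E}.
      x A * y B * (- qint 2) ^ loops n A B)"
    unfolding tl_mult_def by (rule sum.cong) auto
  also have "\<dots> = (\<Sum>(A, B)\<in>diagrams n \<times> diagrams n.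
      y B * (x A * ((- qint 2) ^ loops n A B * (if stack n A B = E then 1 else 0))))"
    by (subst sum.inter_filter) (auto intro!: sum.cong simp: mult_ac)
  also have "\<dots> = (\<Sum>A\<in>diagrams n. \<Sum>B\<in>diagrams n.
      y B * (x A * ((- qint 2) ^ loops n A B * (if stack n A B = E then 1 else 0))))"
    by (simp add: sum.cartesian_product)
  also have "\<dots> = (\<Sum>B\<in>diagrams n. \<Sum>A\<in>diagrams n.
      y B * (x A * ((- qint 2) ^ loops n A B * (if stack n A B = E then 1 else 0))))"
    by (rule sum.swap)
  finally show ?thesis by (simp add: sum_distrib_left)
qed

definition right_killed :: "nat \<Rightarrow> tl \<Rightarrow> bool" where
  "right_killed n x \<longleftrightarrow> (\<forall>i\<in>{1..<n}. tl_mult n x (tl_e n i) = tl_zero)"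

definition left_killed :: "nat \<Rightarrow> tl \<Rightarrow> bool" where
  "left_killed n x \<longleftrightarrow> (\<forall>i\<in>{1..<n}. tl_mult n (tl_e n i) x = tl_zero)"

lemma tl_mult_tl_e:
  assumes i: "1 \<le> i" "i < n"
  shows "tl_mult n x (tl_e n i) E = (\<Sum>A\<in>diagrams n.
    x A * ((- qint 2) ^ loops n A (cup_cap n i) * (if stack n A (cup_cap n i) = E then 1 else 0)))"
  unfolding tl_mult_alt tl_e_def basis_def
  using cup_cap_diagrams[OF i] by (simp add: if_distrib[of "\<lambda>c. c * _"] cong: if_cong)

text \<open>Grouping the diagrams by their product with the generator turns the sum into the
  vanishing coefficients of \<open>x e\<^sub>i\<close>, each weighted by a value of \<phi>.\<close>

lemma right_killed_cap:
  assumes x: "right_killed n x" and i: "1 \<le> i" "i < n"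
  shows "(\<Sum>A\<in>diagrams n. x A * ((- qint 2) ^ loops n A (cup_cap n i) * \<phi> (stack n A (cup_cap n i)))) = 0"
proof -
  let ?S = "\<lambda>A. stack n A (cup_cap n i)"
  let ?f = "\<lambda>A. x A * (- qint 2) ^ loops n A (cup_cap n i)"
  have zero: "(\<Sum>A\<in>{A \<in> diagrams n. ?S A = E}. ?f A) = 0" for E
  proof -
    have "(\<Sum>A\<in>{A \<in> diagrams n. ?S A = E}. ?f A) = tl_mult n x (tl_e n i) E"
      unfolding tl_mult_tl_e[OF i] by (subst sum.inter_filter) (auto intro!: sum.cong)
    then show ?thesis using x i by (simp add: right_killed_def tl_zero_def)
  qed
  have "(\<Sum>A\<in>diagrams n. ?f A * \<phi> (?S A)) =
    (\<Sum>E\<in>?S ` diagrams n. \<Sum>A\<in>{A \<in> diagrams n. ?S A = E}. ?f A * \<phi> (?S A))"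
    by (rule sum.image_gen) simp
  also have "\<dots> = (\<Sum>E\<in>?S ` diagrams n. (\<Sum>A\<in>{A \<in> diagrams n. ?S A = E}. ?f A) * \<phi> E)"
    by (intro sum.cong refl) (simp add: sum_distrib_right)
  also have "\<dots> = 0" by (simp add: zero)
  finally show ?thesis by (simp add: mult.assoc)
qed

text \<open>\<open>B\<close> has an upper cup at some \<open>i\<close>, so
  \<open>- [2] x B = (x e\<^sub>i) B = 0\<close>, and \<open>[2]\<close> is nonzero. The comparison
  is made diagram by diagram, with the loops counted by
  \<open>stack_cup_cap_diagram_of\<close>.\<close>

lemma right_killed_diagram:
  assumes x: "right_killed n x" and B: "B \<in> diagrams n" "B \<noteq> id_diagram n"
  shows "(\<Sum>A\<in>diagrams n. x A * ((- qint 2) ^ loops n A B * (if stack n A B = E then 1 else 0))) = 0"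
    (is "?L = 0")
proof -
  obtain i where i: "1 \<le> i" "i < n" "{Upper i, Upper (Suc i)} \<in> B"
    using diagram_id_or_upper_cap[OF B] by blast
  let ?\<phi> = "\<lambda>C. (- qint 2) ^ loops n C B * (if stack n C B = E then 1 else 0)"
  have "- qint 2 * ?L = (\<Sum>A\<in>diagrams n. x A *
      ((- qint 2) ^ loops n A (cup_cap n i) * ?\<phi> (stack n A (cup_cap n i))))"
    unfolding sum_distrib_left
  proof (rule sum.cong)
    fix A assume "A \<in> diagrams n"
    then obtain m where m: "m \<in> ncm n" "A = diagram_of n m"
      using bij_betw_imp_surj_on[OF bij_betw_diagram_of] by blast
    let ?C = "stack n A (cup_cap n i)"
    have "stack n ?C B = stack n A B" and
      lp: "loops n ?C B + loops n A (cup_cap n i) = Suc (loops n A B)"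
      using stack_cup_cap_diagram_of(3)[OF m(1) i(1,2) diagrams_pairings[OF B(1)] i(3)]
        stack_cup_cap_diagram_of(1)[OF m(1) i(1,2)] m(2) by auto
    have "(- qint 2) ^ loops n A (cup_cap n i) * (- qint 2) ^ loops n ?C B =
        - qint 2 * (- qint 2) ^ loops n A B"
      unfolding power_add[symmetric] using lp by (simp add: add.commute)
    then show "- qint 2 * (x A * ((- qint 2) ^ loops n A B * (if stack n A B = E then 1 else 0))) =
      x A * ((- qint 2) ^ loops n A (cup_cap n i) * ?\<phi> ?C)"
      unfolding \<open>stack n ?C B = stack n A B\<close> by (simp add: mult_ac)
  qed simp
  also have "\<dots> = 0" using right_killed_cap[OF x i(1,2)] .
  finally show ?thesis using qint_nonzero[of 2] by simp
qed

lemma right_killed_mult: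
  assumes x: "right_killed n x" "x \<in> TL n"
  shows "tl_mult n x y = (\<lambda>E. y (id_diagram n) * x E)"
proof
  fix E
  let ?h = "\<lambda>B. (\<Sum>A\<in>diagrams n.
     x A * ((- qint 2) ^ loops n A B * (if stack n A B = E then 1 else 0)))"
  have "tl_mult n x y E = (\<Sum>B\<in>diagrams n. if B = id_diagram n then y B * ?h B else 0)"
    unfolding tl_mult_alt by (rule sum.cong) (simp_all add: right_killed_diagram[OF x(1)])
  also have "\<dots> = y (id_diagram n) * ?h (id_diagram n)"
    using id_diagrams by simp
  also have "?h (id_diagram n) = (\<Sum>A\<in>diagrams n. if A = E then x A else 0)"
    by (rule sum.cong) (simp_all add: stack_id diagrams_pairings)
  also have "\<dots> = x E" using x(2) by (simp add: TL_def)
  finally show "tl_mult n x y E = y (id_diagram n) * x E" .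
qed

section \<open>Reflection as an anti-automorphism of the algebra\<close>

definition refl_tl :: "tl \<Rightarrow> tl" where
  "refl_tl x = (\<lambda>D. x (refl_diagram D))"

lemma refl_tl_refl_tl [simp]: "refl_tl (refl_tl x) = x"
  by (simp add: refl_tl_def)

lemma bij_refl: "bij_betw refl_diagram (diagrams n) (diagrams n)"
  by (rule bij_betw_byWitness[of _ refl_diagram]) (auto simp: refl_diagrams)

lemma refl_tl_TL: "x \<in> TL n \<Longrightarrow> refl_tl x \<in> TL n"
  using refl_diagrams[of "refl_diagram _" n] by (auto simp: TL_def refl_tl_def)

lemma tl_mult_refl: "tl_mult n (refl_tl y) (refl_tl x) = refl_tl (tl_mult n x y)"
proof
  fix E
  let ?w = "\<lambda>A B E. (- qint 2) ^ loops n A B * (if stack n A B = E then 1 else 0)"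
  have w: "?w (refl_diagram B) (refl_diagram A) E = ?w A B (refl_diagram E)" for A B
  proof -
    have "refl_diagram (stack n A B) = E \<longleftrightarrow> stack n A B = refl_diagram E"
      using refl_refl[of E] refl_refl[of "stack n A B"] by auto
    then show ?thesis unfolding loops_refl stack_refl by simp
  qed
  have "tl_mult n (refl_tl y) (refl_tl x) E = (\<Sum>A\<in>diagrams n. \<Sum>B\<in>diagrams n.
      refl_tl x A * (refl_tl y B * ?w B A E))"
    by (simp add: tl_mult_alt sum_distrib_left)
  also have "\<dots> = (\<Sum>A\<in>diagrams n. \<Sum>B\<in>diagrams n.
      x A * (y B * ?w (refl_diagram B) (refl_diagram A) E))"
    by (subst (1 2) sum.reindex_bij_betw[OF bij_refl, symmetric]) (simp add: refl_tl_def)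
  also have "\<dots> = (\<Sum>B\<in>diagrams n. \<Sum>A\<in>diagrams n. x A * (y B * ?w A B (refl_diagram E)))"
    unfolding w by (rule sum.swap)
  also have "\<dots> = refl_tl (tl_mult n x y) E"
    by (simp add: tl_mult_alt refl_tl_def sum_distrib_left mult_ac)
  finally show "tl_mult n (refl_tl y) (refl_tl x) E = refl_tl (tl_mult n x y) E" .
qed

lemma refl_tl_e: "refl_tl (tl_e n i) = tl_e n i"
proof
  fix E
  have "refl_diagram E = cup_cap n i \<longleftrightarrow> E = cup_cap n i"
  proof
    assume "refl_diagram E = cup_cap n i"
    then have "refl_diagram (refl_diagram E) = refl_diagram (cup_cap n i)" by (rule arg_cong)
    then show "E = cup_cap n i" by (simp only: refl_refl refl_cup_cap)
  qed (simp only: refl_cup_cap)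
  then show "refl_tl (tl_e n i) E = tl_e n i E"
    by (simp add: refl_tl_def tl_e_def basis_def)
qed

lemma left_killed_refl: "left_killed n x \<longleftrightarrow> right_killed n (refl_tl x)"
proof -
  have "tl_mult n (refl_tl x) (tl_e n i) = refl_tl (tl_mult n (tl_e n i) x)" for i
    using tl_mult_refl[of n x "tl_e n i"] by (simp add: refl_tl_e)
  moreover have "refl_tl y = tl_zero \<longleftrightarrow> y = tl_zero" for y
  proof
    assume "refl_tl y = tl_zero"
    then have "refl_tl (refl_tl y) = refl_tl tl_zero" by simp
    then show "y = tl_zero" by (simp add: refl_tl_def tl_zero_def)
  qed (simp add: refl_tl_def tl_zero_def)
  ultimately show ?thesis unfolding left_killed_def right_killed_def by simp
qed

lemma left_killed_mult:
  assumes y: "left_killed n y" "y \<in> TL n"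
  shows "tl_mult n x y = (\<lambda>E. x (id_diagram n) * y E)"
proof -
  have "tl_mult n x y = refl_tl (tl_mult n (refl_tl y) (refl_tl x))"
    unfolding tl_mult_refl by simp
  also have "\<dots> = refl_tl (\<lambda>E. refl_tl x (id_diagram n) * refl_tl y E)"
    using right_killed_mult[OF y(1)[unfolded left_killed_refl] refl_tl_TL[OF y(2)]] by simp
  also have "\<dots> = (\<lambda>E. x (id_diagram n) * y E)"
    by (simp add: refl_tl_def refl_id)
  finally show ?thesis .
qed

text \<open>Supplies both existence and uniqueness for \<open>THE\<close>. A product with a killed
  factor only sees the identity coefficient of the other factor, so the products \<open>g g*\<close>
  and \<open>f g\<close> can each be evaluated from both sides.\<close>

lemma jones_wenzl_eq:
  assumes g: "g \<in> TL n" "right_killed n g" "g (id_diagram n) = 1"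
  shows "jones_wenzl n = g"
proof -
  let ?g' = "refl_tl g"
  have g': "?g' \<in> TL n" "left_killed n ?g'" "?g' (id_diagram n) = 1"
    using refl_tl_TL[OF g(1)] g(2,3) by (simp_all add: left_killed_refl) (simp add: refl_tl_def refl_id)
  have "tl_mult n g ?g' = g" using right_killed_mult[OF g(2,1), of ?g'] g'(3) by simp
  moreover have "tl_mult n g ?g' = ?g'" using left_killed_mult[OF g'(2,1), of g] g(3) by simp
  ultimately have "?g' = g" by simp
  with g'(2) have gl: "left_killed n g" by simp
  have "tl_mult n g g = g" using right_killed_mult[OF g(2,1), of g] g(3) by simp
  moreover have "g \<noteq> tl_zero" using g(3) by (auto simp: tl_zero_def)
  ultimately have "is_jones_wenzl n g"
    using g gl by (simp add: is_jones_wenzl_def right_killed_def left_killed_def)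
  moreover have "f = g" if f: "is_jones_wenzl n f" for f
  proof -
    have f': "f \<in> TL n" "right_killed n f" "tl_mult n f f = f" "f \<noteq> tl_zero"
      using f by (auto simp: is_jones_wenzl_def right_killed_def)
    obtain E where "f E \<noteq> 0" using f'(4) unfolding tl_zero_def by blast
    \<comment> \<open>Idempotence says that \<open>f\<close> is its identity coefficient times
      itself; a nonzero entry forces that coefficient to be 1.\<close>
    moreover have "f (id_diagram n) * f E = f E"
      using right_killed_mult[OF f'(2,1), of f] f'(3) by metis
    ultimately have "f (id_diagram n) = 1" by simp
    then have "tl_mult n f g = g" using left_killed_mult[OF gl g(1), of f] by simp
    moreover have "tl_mult n f g = f" using right_killed_mult[OF f'(2,1), of g] g(3) by simp
    ultimately show ?thesis by simp
  qed
  ultimately show ?thesis unfolding jones_wenzl_def by (rule the_equality)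
qed

section \<open>The weight vector is the Jones-Wenzl idempotent\<close>

definition weight_tl :: "nat \<Rightarrow> tl" where
  "weight_tl n D = (if D \<in> diagrams n then 1 / qfact n * (\<Sum>s\<in>index_set n D. qint_seq n (tau s)) else 0)"

lemma weight_tl_diagram_of: "m \<in> ncm n \<Longrightarrow> weight_tl n (diagram_of n m) = 1 / qfact n * weight n m"
  using bij_betwE[OF bij_betw_diagram_of] by (simp add: weight_tl_def weight_def index_set_diagram_of)

text \<open>The coefficient of the product at \<open>E\<close> is the sum in
  \<open>weight_contract\<close>, with \<phi> the indicator of those contracted matchings that
  become \<open>E\<close> once the cap at \<open>i\<close> is put back.\<close>

lemma right_killed_weight: "right_killed n (weight_tl n)"
  unfolding right_killed_def
proof
  fix i assume "i \<in> {1..<n}"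
  then have i: "1 \<le> i" "i < n" by auto
  show "tl_mult n (weight_tl n) (tl_e n i) = tl_zero"
  proof
    fix E
    have "tl_mult n (weight_tl n) (tl_e n i) E = (\<Sum>m\<in>ncm n. weight_tl n (diagram_of n m) *
      ((- qint 2) ^ loops n (diagram_of n m) (cup_cap n i) *
        (if stack n (diagram_of n m) (cup_cap n i) = E then 1 else 0)))"
      unfolding tl_mult_tl_e[OF i] by (rule sum.reindex_bij_betw[OF bij_betw_diagram_of, symmetric])
    also have "\<dots> = (\<Sum>m\<in>ncm n. 1 / qfact n * (weight n m *
      (loop_factor i m * (if diagram_of n (insert_cap i (contract i m)) = E then 1 else 0))))"
      by (rule sum.cong) (simp_all add: weight_tl_diagram_of stack_cup_cap_diagram_of(1,2)[OF _ i] loop_factor_def)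
    also have "\<dots> = 0"
      unfolding sum_distrib_left[symmetric]
      using weight_contract[OF i, of "\<lambda>c. if diagram_of n (insert_cap i c) = E then 1 else 0"] by simp
    finally show "tl_mult n (weight_tl n) (tl_e n i) E = tl_zero E" by (simp add: tl_zero_def)
  qed
qed

theorem proposition5p1:
  fixes n :: nat and D :: diagram
  assumes "n \<ge> 1" and "D \<in> diagrams n"
  shows "jones_wenzl n D = 1 / qfact n * (\<Sum>s\<in>index_set n D. qint_seq n (tau s))"
proof -
  have "weight_tl n (id_diagram n) = 1"
    using weight_tl_diagram_of[OF nest_ncm] by (simp add: diagram_of_nest weight_nest qfact_nonzero)
  moreover have "weight_tl n \<in> TL n" by (simp add: TL_def weight_tl_def)
  ultimately have "jones_wenzl n = weight_tl n"
    using right_killed_weight by (intro jones_wenzl_eq)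
  then show ?thesis using assms(2) by (simp add: weight_tl_def)
qed

end
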